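(* Suppose $A\subset\mathbb{N}_0$ is such that there exist $A'\subset\mathbb{N}_0$ and $R\in\mathbb{N}$, $R\geq2$, with $A\oplus A'=\{0,\dots,R-1\}$ and $A\neq\{0\}$, $A'\neq\{0\}$. Then: (i) There exist finite subsets $L,L'\subset\{0,\dots,R-1\}$ such that $L\oplus L'=\{0,\dots,R-1\}$ and such that $(R,A,L)$ and $(R,A',L')$ are Hadamard systems. Also $\gcd(A)$ divides $R$, and $L$ can be picked such that $\gcd(A)\cdot\max(L)<R$; similarly, $\gcd(A')$ divides $R$ and $L'$ can be picked (together with $L$) such that $\gcd(A')\cdot\max(L')<R$. (ii) Let $\mu_A$ and $\mu_{A'}$ be the invariant measures associated to the affine IFSs $(R,A)$ and $(R,A')$ respectively. Then the convolution $\mu_A\ast\mu_{A'}$ is the Lebesgue measure restricted to $[0,1]$. (iii) For $L,L'$ picked as in (i) (with all the properties listed there), $\mu_A$ is spectral with spectrum $\Gamma(L)=\{\sum_{k=0}^nR^kl_k: l_k\in L,\ n\in\mathbb{N}_0\}$, and $\mu_{A'}$ is spectral with spectrum $\Gamma(L')=\{\sum_{k=0}^nR^kl_k: l_k\in L',\ n\in\mathbb{N}_0\}$. (iv) For such $L,L'$, the kernels satisfy $G_{\Gamma(L)}G_{\Gamma(L')}=k$, where $k$ is the classical Szegő kernel; that is, $$G_{\Gamma(L)}(z,x)\,G_{\Gamma(L')}(z,x)=\frac{1}{1-\overline{z}\,e^{2\pi i x}},\quad (z\in\mathbb{D},\ x\in\mathbb{R}).$$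
   Context: $\mathbb{N}_0=\{0,1,2,\dots\}$; $\mathbb{D}$ is the open unit disk; $e_t(x)=e^{2\pi i tx}$. $A\oplus A'=\{0,\dots,R-1\}$ means that $A+A'=\{0,\dots,R-1\}$ and every $k\in\{0,\dots,R-1\}$ can be written uniquely as $k=a+a'$ with $a\in A$, $a'\in A'$; likewise for $L\oplus L'$. $\gcd(A)$ is the greatest common divisor of the elements of $A$. For a real number $R$ and finite sets $B,L\subset\mathbb{R}$, $(R,B,L)$ is a Hadamard system if $\#B=\#L$ and the matrix $\frac{1}{\sqrt{\#B}}\left(e^{2\pi i R^{-1}bl}\right)_{b\in B,l\in L}$ is unitary. For an integer $R\geq2$ and a finite set $B\subset\mathbb{R}$, the affine IFS $(R,B)$ consists of the maps $\tau_b(x)=R^{-1}(x+b)$, $b\in B$, $x\in\mathbb{R}$; its invariant measure $\mu_B$ is the unique Borel probability measure on $\mathbb{R}$ with $\mu_B(E)=\frac{1}{\#B}\sum_{b\in B}\mu_B(\tau_b^{-1}(E))$ for all Borel sets $E\subset\mathbb{R}$. A Borel probability measure $\mu$ on $\mathbb{R}$ is spectral with spectrum $\Gamma$ if $\{e_\gamma:\gamma\in\Gamma\}$ is an orthonormal basis of $L^2(\mu)$. For $\Gamma\subset\mathbb{N}_0$, $G_\Gamma(z,x)=\sum_{\gamma\in\Gamma}\overline{z}^{\,\gamma}e_\gamma(x)$ for $z\in\mathbb{D}$, $x\in\mathbb{R}$ (with $0^0=1$). The classical Szegő kernel is $k(z,\xi)=\frac{1}{1-\overline{z}\xi}$, here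 evaluated at $\xi=e_1(x)=e^{2\pi ix}$. *)

theory Defs
  imports "HOL-Probability.Probability"
begin

definition e :: "real \<Rightarrow> real \<Rightarrow> complex" where
  "e t x = exp (2 * complex_of_real pi * \<i> * complex_of_real t * complex_of_real x)"

definition direct_sum :: "nat set \<Rightarrow> nat set \<Rightarrow> nat set \<Rightarrow> bool" where
  "direct_sum A A' C \<longleftrightarrow>
     {a + a' | a a'. a \<in> A \<and> a' \<in> A'} = C \<and>
     (\<forall>k\<in>C. \<exists>!p. p \<in> A \<times> A' \<and> k = fst p + snd p)"

text \<open>A matrix with rows indexed by the finite set \<open>I\<close> and columns indexed by the finite
  set \<open>J\<close> is unitary if both products with its adjoint are identity matrices.\<close>

definition unitary_on :: "'i set \<Rightarrow> 'j set \<Rightarrow> ('i \<Rightarrow> 'j \<Rightarrow> complex) \<Rightarrow> bool" where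
  "unitary_on I J U \<longleftrightarrow>
     (\<forall>i\<in>I. \<forall>i'\<in>I. (\<Sum>j\<in>J. U i j * cnj (U i' j)) = (if i = i' then 1 else 0)) \<and>
     (\<forall>j\<in>J. \<forall>j'\<in>J. (\<Sum>i\<in>I. cnj (U i j) * U i j') = (if j = j' then 1 else 0))"

definition hadamard_system :: "real \<Rightarrow> real set \<Rightarrow> real set \<Rightarrow> bool" where
  "hadamard_system R B L \<longleftrightarrow>
     finite B \<and> finite L \<and> card B = card L \<and>
     unitary_on B L
       (\<lambda>b l. 1 / complex_of_real (sqrt (real (card B))) *
          exp (2 * complex_of_real pi * \<i> * complex_of_real (inverse R * b * l)))"

definition ifs_map :: "nat \<Rightarrow> real \<Rightarrow> real \<Rightarrow> real" where
  "ifs_map R b x = inverse (real R) * (x + b)"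

definition is_invariant_measure :: "nat \<Rightarrow> real set \<Rightarrow> real measure \<Rightarrow> bool" where
  "is_invariant_measure R B \<mu> \<longleftrightarrow>
     prob_space \<mu> \<and> sets \<mu> = sets borel \<and>
     (\<forall>E\<in>sets borel.
        measure \<mu> E = 1 / real (card B) * (\<Sum>b\<in>B. measure \<mu> (ifs_map R b -` E)))"

definition invariant_measure :: "nat \<Rightarrow> real set \<Rightarrow> real measure" where
  "invariant_measure R B = (THE \<mu>. is_invariant_measure R B \<mu>)"

definition square_integrable :: "'a measure \<Rightarrow> ('a \<Rightarrow> complex) \<Rightarrow> bool" where
  "square_integrable M f \<longleftrightarrow>
     f \<in> borel_measurable M \<and> integrable M (\<lambda>x. (norm (f x))\<^sup>2)"

text \<open>Elements of \<open>L\<^sup>2(M)\<close> are represented by square-integrable functions. The family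
  \<open>(\<phi> i)\<close>, \<open>i \<in> I\<close>, is an orthonormal basis if it is orthonormal and its finite linear
  combinations are dense in the \<open>L\<^sup>2\<close> norm.\<close>

definition orthonormal_basis_L2 :: "'a measure \<Rightarrow> 'i set \<Rightarrow> ('i \<Rightarrow> 'a \<Rightarrow> complex) \<Rightarrow> bool" where
  "orthonormal_basis_L2 M I \<phi> \<longleftrightarrow>
     (\<forall>i\<in>I. square_integrable M (\<phi> i)) \<and>
     (\<forall>i\<in>I. \<forall>j\<in>I. (LINT x|M. \<phi> i x * cnj (\<phi> j x)) = (if i = j then 1 else 0)) \<and>
     (\<forall>f. square_integrable M f \<longrightarrow>
        (\<forall>\<epsilon>>0. \<exists>F c. finite F \<and> F \<subseteq> I \<and>
           sqrt (LINT x|M. (norm (f x - (\<Sum>i\<in>F. c i * \<phi> i x)))\<^sup>2) < \<epsilon>))"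

definition spectral_with_spectrum :: "real measure \<Rightarrow> real set \<Rightarrow> bool" where
  "spectral_with_spectrum \<mu> \<Gamma> \<longleftrightarrow>
     prob_space \<mu> \<and> sets \<mu> = sets borel \<and> orthonormal_basis_L2 \<mu> \<Gamma> e"

definition digit_sums :: "nat \<Rightarrow> nat set \<Rightarrow> nat set" where
  "digit_sums R L = {(\<Sum>k\<le>n. R ^ k * l k) | n l. \<forall>k\<le>n. l k \<in> L}"

definition G_kernel :: "nat set \<Rightarrow> complex \<Rightarrow> real \<Rightarrow> complex" where
  "G_kernel \<Gamma> z x = (\<Sum>\<^sub>\<infinity>\<gamma>\<in>\<Gamma>. cnj z ^ \<gamma> * e (real \<gamma>) x)"

definition szego_kernel :: "complex \<Rightarrow> complex \<Rightarrow> complex" where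
  "szego_kernel z \<xi> = 1 / (1 - cnj z * \<xi>)"

definition picked_pair :: "nat \<Rightarrow> nat set \<Rightarrow> nat set \<Rightarrow> nat set \<Rightarrow> nat set \<Rightarrow> bool" where
  "picked_pair R A A' L L' \<longleftrightarrow>
     finite L \<and> finite L' \<and> L \<subseteq> {0..<R} \<and> L' \<subseteq> {0..<R} \<and>
     direct_sum L L' {0..<R} \<and>
     hadamard_system (real R) (real ` A) (real ` L) \<and>
     hadamard_system (real R) (real ` A') (real ` L') \<and>
     Gcd A * Max L < R \<and> Gcd A' * Max L' < R"

end

theory Submission
  imports Defs
begin

text \<open>
Tilings of an interval have a recursive structure. One of the two sets, say \<open>A\<close>, contains
\<open>1\<close>; if \<open>m\<close> is the least positive element of \<open>A'\<close> (or \<open>R\<close> when there is none), then \<open>A\<close> is a union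
of blocks \<open>{j * m..<j * m + m}\<close> and \<open>A'\<close> consists of multiples of \<open>m\<close>. So \<open>R = m * n\<close>,
\<open>A = {0..<m} + m B\<close> and \<open>A' = m B'\<close>, where \<open>B\<close> and \<open>B'\<close> tile \<open>{0..<n}\<close> (\<open>tiling_structure\<close>).

(i) Given dual sets \<open>M\<close>, \<open>M'\<close> for the smaller tiling, \<open>L = M + n {0..<m}\<close> and \<open>L' = M'\<close> are dual
sets for the larger one: the character sum over \<open>A\<close> splits into one over \<open>B\<close>, which separates
points of \<open>M\<close>, and one over \<open>{0..<m}\<close>, which separates the second digit
(\<open>hadamard_digit_comb\<close>). The bounds on the greatest common divisors are carried along the
induction, because \<open>Gcd A = 1\<close> and \<open>Gcd A' = m * Gcd B'\<close> (\<open>tiling_picked_pair\<close>).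

(ii) The Fourier transform of an invariant measure satisfies the refinement equation
\<open>f t = p (t / R) * f (t / R)\<close> with \<open>p\<close> the average of the exponentials over the digits. Iterating
it shows that a solution continuous at \<open>0\<close> is determined by its value there
(\<open>refinement_equation_unique\<close>). As \<open>A + A'\<close> enumerates \<open>{0..<R}\<close> without repetition, the averages
of \<open>A\<close> and \<open>A'\<close> multiply to the one of \<open>{0..<R}\<close>; hence the convolution satisfies the same
equation as Lebesgue measure on \<open>[0,1]\<close>, and both measures agree.

(iii) Orthogonality: the transform of \<open>\<mu>\<^sub>A\<close> at a difference of two elements of \<open>\<Gamma>(L)\<close> contains
the factor that belongs to the first digit in which they differ, and this factor is \<open>0\<close> by the
Hadamard property. Completeness is reduced to Parseval's identity for each exponential of real
frequency \<open>t\<close>. The sums over the expansions with \<open>n\<close> digits of the squared partial products of the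
transform at \<open>t - \<gamma>\<close> are equal to \<open>1\<close>. To let \<open>n\<close> tend to infinity one needs a positive lower
bound for the remaining factor, the transform at \<open>(t - \<gamma>) / R ^ n\<close>. Since \<open>R - 1\<close> is not a digit
in \<open>L\<close> (otherwise \<open>L' = {0}\<close> and \<open>A' = {0}\<close>), these points eventually stay in a compact subset of \<open>(-1,1)\<close>; and there the transform has
no zero, because by (ii) it divides the transform of Lebesgue measure on \<open>[0,1]\<close>, whose zeros are
the nonzero integers. So all exponentials lie in the closed span, and the Stone-Weierstrass theorem
with a monotone class argument gives all of \<open>L\<^sup>2\<close>.

(iv) Adding an element of \<open>\<Gamma>(L)\<close> to one of \<open>\<Gamma>(L')\<close> produces no carries, so the two sets tile the
natural numbers and the product of the two series is the geometric series.
\<close>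

section \<open>Direct sums of sets of natural numbers\<close>

text \<open>This form gives cardinalities and the reindexing of sums and series at once.\<close>

lemma direct_sum_iff_bij_betw:
  "direct_sum A A' C \<longleftrightarrow> bij_betw (\<lambda>(a, a'). a + a') (A \<times> A') C"
proof
  assume d: "direct_sum A A' C"
  have img: "(\<lambda>(a, a'). a + a') ` (A \<times> A') = C"
    using d unfolding direct_sum_def by force
  have "inj_on (\<lambda>(a, a'). a + a') (A \<times> A')"
  proof (rule inj_onI)
    fix p q assume pq: "p \<in> A \<times> A'" "q \<in> A \<times> A'"
      "(case p of (a, a') \<Rightarrow> a + a') = (case q of (a, a') \<Rightarrow> a + a')"
    then have "fst p + snd p = fst q + snd q" "fst p + snd p \<in> C"
      using img by (auto simp: case_prod_beta)
    with d pq show "p = q" unfolding direct_sum_def by metis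
  qed
  with img show "bij_betw (\<lambda>(a, a'). a + a') (A \<times> A') C" by (simp add: bij_betw_def)
next
  assume b: "bij_betw (\<lambda>(a, a'). a + a') (A \<times> A') C"
  have "\<exists>!p. p \<in> A \<times> A' \<and> k = fst p + snd p" if "k \<in> C" for k
    using b that unfolding bij_betw_def inj_on_def by (auto simp: case_prod_beta)
  moreover have "{a + a' | a a'. a \<in> A \<and> a' \<in> A'} = C"
    using b unfolding bij_betw_def by force
  ultimately show "direct_sum A A' C" unfolding direct_sum_def by blast
qed

lemma direct_sumI:
  assumes "\<And>a a'. a \<in> A \<Longrightarrow> a' \<in> A' \<Longrightarrow> a + a' \<in> C"
    and "\<And>k. k \<in> C \<Longrightarrow> \<exists>a\<in>A. \<exists>a'\<in>A'. k = a + a'"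
    and "\<And>a a' b b'. a \<in> A \<Longrightarrow> a' \<in> A' \<Longrightarrow> b \<in> A \<Longrightarrow> b' \<in> A' \<Longrightarrow> a + a' = b + b' \<Longrightarrow> a = b \<and> a' = b'"
  shows "direct_sum A A' C"
  unfolding direct_sum_iff_bij_betw bij_betw_def inj_on_def
  using assms by (fastforce simp: image_iff)

lemma direct_sum_memD: "direct_sum A A' C \<Longrightarrow> a \<in> A \<Longrightarrow> a' \<in> A' \<Longrightarrow> a + a' \<in> C"
  unfolding direct_sum_def by blast

lemma direct_sumE:
  assumes "direct_sum A A' C" "k \<in> C"
  obtains a a' where "a \<in> A" "a' \<in> A'" "k = a + a'"
  using assms unfolding direct_sum_def by blast

lemma direct_sum_unique:
  assumes "direct_sum A A' C" "a \<in> A" "a' \<in> A'" "b \<in> A" "b' \<in> A'" "a + a' = b + b'"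
  shows "a = b" "a' = b'"
  using assms unfolding direct_sum_iff_bij_betw bij_betw_def inj_on_def by auto

lemma direct_sum_commute:
  assumes d: "direct_sum A A' C"
  shows "direct_sum A' A C"
proof (rule direct_sumI)
  show "a + a' \<in> C" if "a \<in> A'" "a' \<in> A" for a a'
    using direct_sum_memD[OF d that(2,1)] by (simp add: add.commute)
  show "\<exists>a\<in>A'. \<exists>a'\<in>A. k = a + a'" if "k \<in> C" for k
    using direct_sumE[OF d that] by (metis add.commute)
  show "a = b \<and> a' = b'"
    if "a \<in> A'" "a' \<in> A" "b \<in> A'" "b' \<in> A" "a + a' = b + b'" for a a' b b'
    using direct_sum_unique[OF d that(2,1) that(4,3)] that(5) by (simp add: add.commute)
qed

lemma direct_sum_zero_mem:
  assumes "direct_sum A A' C" "0 \<in> C"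
  shows "0 \<in> A" "0 \<in> A'"
  using direct_sumE[OF assms] by auto

lemma direct_sum_subset:
  assumes "direct_sum A A' C" "0 \<in> C"
  shows "A \<subseteq> C" "A' \<subseteq> C"
  using direct_sum_zero_mem[OF assms] direct_sum_memD[OF assms(1)] by fastforce+

lemma direct_sum_card:
  assumes "direct_sum A A' C"
  shows "card A * card A' = card C"
  using bij_betw_same_card[OF assms[unfolded direct_sum_iff_bij_betw]]
  by (simp add: card_cartesian_product)

section \<open>Sets given by their lowest digit\<close>

text \<open>The numbers \<open>r + m * b\<close> with lowest digit \<open>r\<close> in \<open>P\<close> and remaining digits \<open>b\<close> in \<open>B\<close>. The same
operation builds tilings, their duals and the candidate spectra.\<close>

definition digit_comb :: "nat \<Rightarrow> nat set \<Rightarrow> nat set \<Rightarrow> nat set" where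
  "digit_comb m P B = (\<lambda>(r, b). r + m * b) ` (P \<times> B)"

lemma digit_comb_mem: "r \<in> P \<Longrightarrow> b \<in> B \<Longrightarrow> r + m * b \<in> digit_comb m P B"
  by (auto simp: digit_comb_def)

lemma digit_comb_zero_left: "digit_comb m {0} B = (*) m ` B"
  by (auto simp: digit_comb_def image_iff)

lemma digit_comb_zero_right: "digit_comb m P {0} = P"
  by (force simp: digit_comb_def image_iff)

lemma digit_eq_iff:
  fixes m :: nat
  assumes "r < m" "r' < m"
  shows "r + m * b = r' + m * b' \<longleftrightarrow> r = r' \<and> b = b'"
proof
  assume eq: "r + m * b = r' + m * b'"
  have "(r + m * b) mod m = r" "(r' + m * b') mod m = r'"
    "(r + m * b) div m = b" "(r' + m * b') div m = b'" using assms by simp_all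
  with eq show "r = r' \<and> b = b'" by metis
qed simp

lemma inj_on_digits:
  fixes m :: nat
  assumes "P \<subseteq> {0..<m}"
  shows "inj_on (\<lambda>(r, b). r + m * b) (P \<times> B)"
proof (rule inj_onI)
  fix p q assume pq: "p \<in> P \<times> B" "q \<in> P \<times> B"
    "(case p of (r, b) \<Rightarrow> r + m * b) = (case q of (r, b) \<Rightarrow> r + m * b)"
  then have "fst p < m" "fst q < m" using assms by auto
  with pq(3) digit_eq_iff[of "fst p" m "fst q" "snd p" "snd q"] show "p = q"
    by (simp add: case_prod_beta prod_eq_iff)
qed

lemma digit_comb_subset:
  assumes "P \<subseteq> {0..<m}" "B \<subseteq> {0..<n}"
  shows "digit_comb m P B \<subseteq> {0..<m * n}"
proof
  fix x assume "x \<in> digit_comb m P B"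
  then obtain r b where x: "x = r + m * b" "r < m" "b < n" using assms unfolding digit_comb_def by fastforce
  then have "m * Suc b \<le> m * n" by (intro mult_le_mono2) simp
  then show "x \<in> {0..<m * n}" using x by simp
qed

lemma sum_digit_comb:
  assumes "P \<subseteq> {0..<m}"
  shows "sum f (digit_comb m P B) = (\<Sum>r\<in>P. \<Sum>b\<in>B. f (r + m * b))"
  unfolding digit_comb_def
  by (subst sum.reindex[OF inj_on_digits[OF assms]]) (simp add: sum.cartesian_product case_prod_beta)

lemma card_digit_comb: "P \<subseteq> {0..<m} \<Longrightarrow> card (digit_comb m P B) = card P * card B"
  unfolding digit_comb_def by (simp add: card_image inj_on_digits card_cartesian_product)

text \<open>No carries occur: the sum of two lowest digits is again below \<open>m\<close>, so digits can be added
and compared separately.\<close>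

lemma direct_sum_digit_comb:
  assumes P: "direct_sum P P' {0..<m}" and B: "direct_sum B B' C"
  shows "direct_sum (digit_comb m P B) (digit_comb m P' B') (digit_comb m {0..<m} C)"
proof (rule direct_sumI)
  fix a a' assume "a \<in> digit_comb m P B" "a' \<in> digit_comb m P' B'"
  then obtain r b r' b' where *: "r \<in> P" "b \<in> B" "r' \<in> P'" "b' \<in> B'" "a = r + m * b" "a' = r' + m * b'"
    by (auto simp: digit_comb_def)
  then have "a + a' = (r + r') + m * (b + b')" by (simp add: algebra_simps)
  then show "a + a' \<in> digit_comb m {0..<m} C"
    using direct_sum_memD[OF P] direct_sum_memD[OF B] * by (metis digit_comb_mem)
next
  fix k assume "k \<in> digit_comb m {0..<m} C"
  then obtain s c where k: "k = s + m * c" "s \<in> {0..<m}" "c \<in> C" by (auto simp: digit_comb_def)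
  obtain r r' where r: "r \<in> P" "r' \<in> P'" "s = r + r'" by (rule direct_sumE[OF P k(2)])
  obtain b b' where b: "b \<in> B" "b' \<in> B'" "c = b + b'" by (rule direct_sumE[OF B k(3)])
  have "k = (r + m * b) + (r' + m * b')" using k r b by (simp add: algebra_simps)
  then show "\<exists>a\<in>digit_comb m P B. \<exists>a'\<in>digit_comb m P' B'. k = a + a'"
    using r b digit_comb_mem by blast
next
  fix a a' c c'
  assume "a \<in> digit_comb m P B" "a' \<in> digit_comb m P' B'" "c \<in> digit_comb m P B" "c' \<in> digit_comb m P' B'"
    and eq: "a + a' = c + c'"
  then obtain r b r' b' s d s' d' where *: "r \<in> P" "b \<in> B" "r' \<in> P'" "b' \<in> B'" "a = r + m * b" "a' = r' + m * b'"
    "s \<in> P" "d \<in> B" "s' \<in> P'" "d' \<in> B'" "c = s + m * d" "c' = s' + m * d'"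
    by (auto simp: digit_comb_def)
  have "(r + r') + m * (b + b') = (s + s') + m * (d + d')"
    using eq * by (simp add: algebra_simps)
  moreover have "r + r' < m" "s + s' < m"
    using direct_sum_memD[OF P] * by auto
  ultimately have "r + r' = s + s'" "b + b' = d + d'" by (simp_all add: digit_eq_iff)
  then show "a = c \<and> a' = c'"
    using direct_sum_unique[OF P, of r r' s s'] direct_sum_unique[OF B, of b b' d d'] * by simp
qed

lemma digit_comb_interval: "0 < m \<Longrightarrow> digit_comb m {0..<m} {0..<n} = {0..<m * n}"
proof
  assume m: "0 < m"
  show "{0..<m * n} \<subseteq> digit_comb m {0..<m} {0..<n}"
  proof
    fix x assume x: "x \<in> {0..<m * n}"
    have "x mod m + m * (x div m) \<in> digit_comb m {0..<m} {0..<n}"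
      using x m by (intro digit_comb_mem) (auto simp: less_mult_imp_div_less mult.commute)
    then show "x \<in> digit_comb m {0..<m} {0..<n}" by simp
  qed
qed (simp add: digit_comb_subset)

section \<open>The structure of tilings of an interval\<close>

text \<open>By induction on \<open>j\<close>, each block \<open>{j * m..<j * m + m}\<close> is contained in \<open>A\<close> or disjoint from it,
and \<open>A'\<close> can only meet it in its first element. The initial block lies in \<open>A\<close> by minimality of \<open>m\<close>.
If neither set contains \<open>j * m\<close>, then \<open>j * m\<close> is a sum of smaller elements, so by the induction
hypothesis the whole block is covered by the translate of an earlier block of \<open>A\<close>, and uniqueness
excludes further elements. If \<open>j * m \<in> A'\<close>, the block is covered in the same way by the translate
of the initial block. If \<open>j * m \<in> A\<close>, uniqueness forces every element of the block into \<open>A\<close>.\<close>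

lemma tiling_blocks:
  assumes d: "direct_sum A A' {0..<R}" and R0: "0 < R" and m: "m \<in> A'" and m0: "0 < m"
    and least: "\<And>a'. a' \<in> A' \<Longrightarrow> a' < m \<Longrightarrow> a' = 0"
  shows "\<forall>r<m. (j * m + r \<in> A \<longleftrightarrow> j * m \<in> A) \<and> (j * m + r \<in> A' \<longrightarrow> r = 0)"
proof (induction j rule: less_induct)
  case (less j)
  have z: "0 \<in> A" "0 \<in> A'" using direct_sum_zero_mem[OF d] R0 by auto
  have mR: "m < R" using direct_sum_memD[OF d z(1) m] by simp
  have low: "r \<in> A" if "r < m" for r
  proof -
    have "r \<in> {0..<R}" using that mR by simp
    then obtain a a' where "a \<in> A" "a' \<in> A'" "r = a + a'" by (rule direct_sumE[OF d])
    with least[of a'] that show ?thesis by auto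
  qed
  have nonzero: False if "k \<in> A" "k \<in> A'" "0 < k" for k
    using direct_sum_unique(1)[OF d that(1) z(2) z(1) that(2)] that(3) by simp
  consider "j = 0" | "j > 0" "j * m \<in> A" | "j > 0" "j * m \<in> A'" | "j > 0" "j * m \<notin> A" "j * m \<notin> A'"
    by blast
  then show ?case
  proof cases
    case 1
    then show ?thesis using low z least by auto
  next
    case 2
    have jm: "0 < j * m" using 2 m0 by simp
    have tail: False if s: "s < m" "j * m + s \<in> A'" for s
    proof (cases "s = 0")
      case True
      then show False using nonzero[OF 2(2)] s jm by simp
    next
      case False
      \<comment> \<open>\<open>(m - s) + (j * m + s)\<close> and \<open>j * m + m\<close> are the same number\<close>
      have "m - s = j * m"
        using direct_sum_unique(1)[OF d low s(2) 2(2) m, of "m - s"] False s(1) by simp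
      moreover have "m - s < m" using False m0 by simp
      moreover have "m \<le> j * m" using 2(1) by simp
      ultimately show False by linarith
    qed
    \<comment> \<open>represent \<open>j * m + r\<close>: a summand in \<open>A'\<close> from this block is excluded by \<open>tail\<close>, and two
      smaller summands would yield a second representation of \<open>j * m\<close>\<close>
    have "j * m + r \<in> A" if r: "r < m" for r
    proof -
      have "j * m + m < R" using direct_sum_memD[OF d 2(2) m] by simp
      then have "j * m + r \<in> {0..<R}" using r by simp
      then obtain a a' where aa: "a \<in> A" "a' \<in> A'" "j * m + r = a + a'"
        by (rule direct_sumE[OF d])
      have "\<not> j * m \<le> a'"
      proof
        assume le: "j * m \<le> a'"
        then have "a' - j * m < m" "j * m + (a' - j * m) \<in> A'" using aa r by simp_all
        then show False by (rule tail)
      qed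
      then have a': "a' < j * m" by simp
      have "\<not> a < j * m"
      proof
        assume a: "a < j * m"
        have ia: "a div m < j" "a' div m < j" using a a' m0 by (simp_all add: less_mult_imp_div_less)
        have "a' mod m = 0"
          using less.IH[OF ia(2)] aa(2) m0 by (metis mod_less_divisor div_mult_mod_eq)
        then have a'm: "a' = (a' div m) * m" by (metis div_mult_mod_eq add.right_neutral)
        have am: "(a div m) * m \<in> A"
          using less.IH[OF ia(1)] aa(1) m0 by (metis mod_less_divisor div_mult_mod_eq)
        have *: "(a div m + a' div m) * m + a mod m = j * m + r"
          using aa(3) a'm by (metis add.commute add.left_commute add_mult_distrib div_mult_mod_eq)
        have "(a div m + a' div m) * m = j * m"
        proof -
          have "((a div m + a' div m) * m + a mod m) div m = a div m + a' div m" "(j * m + r) div m = j"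
            using m0 r by simp_all
          with * show ?thesis by simp
        qed
        then have "(a div m) * m + a' = j * m + 0" using a'm by (simp add: add_mult_distrib)
        then have "a' = 0" using direct_sum_unique(2)[OF d am aa(2) 2(2) z(2)] by simp
        then show False using aa(3) a by simp
      qed
      then obtain s where s: "a = j * m + s" by (metis le_add_diff_inverse not_less)
      then have "a' \<le> r" using aa(3) by simp
      then have "a' = 0" using least[OF aa(2)] r by simp
      then show ?thesis using aa by simp
    qed
    then show ?thesis using tail 2(2) by blast
  next
    case 3
    have jm: "0 < j * m" using 3 m0 by simp
    have A: "j * m + r \<notin> A" if r: "r < m" for r
    proof
      assume "j * m + r \<in> A"
      from direct_sum_unique(1)[OF d this z(2) low[OF r] 3(2)] r jm show False by simp
    qed
    have A': "r = 0" if r: "r < m" "j * m + r \<in> A'" for r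
      using direct_sum_unique(1)[OF d z(1) r(2) low[OF r(1)] 3(2)] by simp
    have "j * m \<notin> A" using A[of 0] m0 by simp
    with A A' show ?thesis by blast
  next
    case 4
    have no: "j * m + r \<notin> A \<and> j * m + r \<notin> A'" if r: "r < m" for r
    proof (rule ccontr)
      assume "\<not> ?thesis"
      then have x: "j * m + r \<in> A \<or> j * m + r \<in> A'" by blast
      then have "j * m + r \<in> {0..<R}" using direct_sum_subset[OF d] R0 by auto
      then have "j * m \<in> {0..<R}" by simp
      then obtain a a' where aa: "a \<in> A" "a' \<in> A'" "j * m = a + a'" by (rule direct_sumE[OF d])
      have lt: "a < j * m" "a' < j * m"
      proof -
        have "a \<noteq> j * m" "a' \<noteq> j * m" using aa(1,2) 4(2,3) by metis+
        then show "a < j * m" "a' < j * m" using aa(3) by linarith+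
      qed
      have ia: "a div m < j" "a' div m < j" using lt m0 by (simp_all add: less_mult_imp_div_less)
      have "a' mod m = 0"
        using less.IH[OF ia(2)] aa(2) m0 by (metis mod_less_divisor div_mult_mod_eq)
      then have "a mod m = 0" using aa(3)
        by (metis dvd_add_left_iff dvd_triv_right mod_0_imp_dvd dvd_imp_mod_0)
      then have "a + r \<in> A"
        using less.IH[OF ia(1)] aa(1) r by (metis add.right_neutral div_mult_mod_eq)
      moreover have "(a + r) + a' = j * m + r" using aa(3) by simp
      ultimately show False
        using x direct_sum_unique(1)[OF d, of "a + r" a' "j * m + r" 0]
          direct_sum_unique(2)[OF d, of "a + r" a' 0 "j * m + r"] aa(2) z lt by auto
    qed
    have "j * m \<notin> A" by fact
    with no show ?thesis by blast
  qed
qed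

text \<open>The case \<open>A' = {0}\<close> is included with \<open>m = R\<close> and \<open>n = 1\<close>, so that the recursion ends at the
trivial tiling of \<open>{0}\<close>.\<close>

lemma tiling_structure:
  assumes d: "direct_sum A A' {0..<R}" and R: "2 \<le> R" and one: "1 \<in> A"
  obtains m n B B' where "2 \<le> m" "R = m * n" "direct_sum B B' {0..<n}"
    "A = digit_comb m {0..<m} B" "A' = (*) m ` B'"
proof (cases "A' = {0}")
  case True
  have "A = {0..<R}" using d unfolding True direct_sum_def by auto
  then have "A = (\<lambda>(r, b). r + R * b) ` ({0..<R} \<times> {0})" by force
  moreover have "direct_sum {0} {0} {0..<1}" by (rule direct_sumI) auto
  ultimately show thesis using that[of R 1 "{0}" "{0}"] True R unfolding digit_comb_def by simp
next
  case False
  have z: "0 \<in> A" "0 \<in> A'" using direct_sum_zero_mem[OF d] R by auto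
  then have ex: "\<exists>a. a \<in> A' \<and> 0 < a" using False by auto
  define m where "m = (LEAST a. a \<in> A' \<and> 0 < a)"
  have m: "m \<in> A'" "0 < m" using LeastI_ex[OF ex] by (simp_all add: m_def)
  have least: "a = 0" if "a \<in> A'" "a < m" for a
    using not_less_Least[of a "\<lambda>a. a \<in> A' \<and> 0 < a"] that unfolding m_def by auto
  have "m \<noteq> 1"
    using direct_sum_unique(1)[OF d one z(2) z(1), of m] m by auto
  then have m2: "2 \<le> m" using m by simp
  have R0: "0 < R" using R by simp
  note bl = tiling_blocks[OF d R0 m least, THEN spec, THEN mp]
  have blA: "a + r \<in> A" if "a \<in> A" "m dvd a" "r < m" for a r
    using bl[of r "a div m"] that by (simp add: dvd_div_mult_self)
  have blA0: "m * (a div m) \<in> A" if "a \<in> A" for a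
    using bl[of "a mod m" "a div m"] that m(2) by (simp add: mult.commute)
  have blA': "m dvd a" if "a \<in> A'" for a
    using bl[of "a mod m" "a div m"] that m(2) by (simp add: mult.commute mod_0_imp_dvd)
  have "m dvd R"
  proof (rule ccontr)
    assume nd: "\<not> m dvd R"
    \<comment> \<open>the block that would be cut off by \<open>R\<close>: a representation of its first element extends to its last\<close>
    define q where "q = m * (R div m)"
    have qR: "q < R" unfolding q_def
    proof -
      have "m * (R div m) \<noteq> R" using nd by (metis dvd_triv_left)
      then show "m * (R div m) < R" using times_div_less_eq_dividend[of m R] by linarith
    qed
    then have "q \<in> {0..<R}" by simp
    then obtain a a' where aa: "a \<in> A" "a' \<in> A'" "q = a + a'" by (rule direct_sumE[OF d])
    have md: "m dvd a" using aa(3) blA'[OF aa(2)] unfolding q_def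
      by (metis dvd_add_left_iff dvd_triv_left)
    have "a + (m - 1) \<in> A" by (rule blA[OF aa(1) md diff_less[OF zero_less_one m(2)]])
    then have "q + (m - 1) < R" using direct_sum_memD[OF d _ aa(2)] aa(3)
      by (metis add.assoc add.commute atLeastLessThan_iff)
    moreover have "R < q + m" using m(2) dividend_less_times_div unfolding q_def
      by (metis add.commute)
    ultimately show False by linarith
  qed
  then obtain n where n: "R = m * n" by blast
  define B B' where "B = {b. m * b \<in> A}" and "B' = {b. m * b \<in> A'}"
  have A'_eq: "A' = (*) m ` B'" unfolding B'_def using blA' by (auto simp: dvd_def)
  have A_eq: "A = (\<lambda>(r, b). r + m * b) ` ({0..<m} \<times> B)"
  proof
    show "(\<lambda>(r, b). r + m * b) ` ({0..<m} \<times> B) \<subseteq> A"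
      unfolding B_def by clarsimp (metis blA add.commute dvd_triv_left)
    show "A \<subseteq> (\<lambda>(r, b). r + m * b) ` ({0..<m} \<times> B)"
    proof
      fix a assume a: "a \<in> A"
      have "a = (\<lambda>(r, b). r + m * b) (a mod m, a div m)" by simp
      moreover have "(a mod m, a div m) \<in> {0..<m} \<times> B" using blA0[OF a] m(2) by (simp add: B_def)
      ultimately show "a \<in> (\<lambda>(r, b). r + m * b) ` ({0..<m} \<times> B)" by (rule image_eqI)
    qed
  qed
  have "direct_sum B B' {0..<n}"
  proof (rule direct_sumI)
    fix b b' assume "b \<in> B" "b' \<in> B'"
    then have "m * b + m * b' < m * n" using direct_sum_memD[OF d] n unfolding B_def B'_def by auto
    then show "b + b' \<in> {0..<n}" by (simp flip: add_mult_distrib2)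
  next
    fix k assume "k \<in> {0..<n}"
    then have "m * k \<in> {0..<R}" using n m by simp
    then obtain a a' where aa: "a \<in> A" "a' \<in> A'" "m * k = a + a'" by (rule direct_sumE[OF d])
    then have "m dvd a'" using blA' by blast
    moreover then have "m dvd a" using aa(3) by (metis dvd_add_left_iff dvd_triv_left)
    ultimately obtain b b' where "a = m * b" "a' = m * b'" unfolding dvd_def by blast
    with aa m show "\<exists>b\<in>B. \<exists>b'\<in>B'. k = b + b'"
      unfolding B_def B'_def by (auto simp flip: add_mult_distrib2)
  next
    fix a a' b b' assume "a \<in> B" "a' \<in> B'" "b \<in> B" "b' \<in> B'" "a + a' = b + b'"
    then show "a = b \<and> a' = b'"
      using direct_sum_unique[OF d, of "m * a" "m * a'" "m * b" "m * b'"] m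
      unfolding B_def B'_def by (auto simp flip: add_mult_distrib2)
  qed
  then show thesis using that m2 n A_eq A'_eq unfolding digit_comb_def by blast
qed

section \<open>Exponential sums\<close>

definition uexp :: "real \<Rightarrow> complex" where
  "uexp x = cis (2 * pi * x)"

lemma e_eq_uexp: "e t x = uexp (t * x)"
  by (simp add: e_def uexp_def cis_conv_exp algebra_simps)

lemma uexp_add: "uexp (x + y) = uexp x * uexp y"
  by (simp add: uexp_def cis_mult algebra_simps)

lemma uexp_diff: "uexp (x - y) = uexp x * cnj (uexp y)"
  by (simp add: uexp_def cis_cnj cis_mult algebra_simps)

lemma cnj_uexp: "cnj (uexp x) = uexp (- x)"
  by (simp add: uexp_def cis_cnj)

lemma norm_uexp [simp]: "norm (uexp x) = 1"
  by (simp add: uexp_def)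

lemma uexp_0 [simp]: "uexp 0 = 1"
  by (simp add: uexp_def)

lemma uexp_eq_1_iff: "uexp x = 1 \<longleftrightarrow> x \<in> \<int>"
proof
  assume "uexp x = 1"
  then have "cos (2 * pi * x) = 1" by (auto simp: uexp_def cis_conv_exp complex_eq_iff Re_exp)
  then obtain n :: int where "2 * pi * x = of_int n * 2 * pi" by (auto simp: cos_one_2pi_int)
  then have "x = of_int n" by simp
  then show "x \<in> \<int>" by simp
next
  assume "x \<in> \<int>"
  then show "uexp x = 1" by (auto simp: uexp_def elim!: Ints_cases intro!: cis_multiple_2pi)
qed

lemma uexp_power: "uexp (real n * x) = uexp x ^ n"
  by (simp only: uexp_def Complex.DeMoivre mult.left_commute)

lemma sum_uexp_geometric:
  "(\<Sum>r\<in>{0..<m}. uexp (real r * t)) * (uexp t - 1) = uexp (real m * t) - 1"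
proof (induction m)
  case (Suc m)
  have "uexp (real (Suc m) * t) = uexp (real m * t) * uexp t"
    by (simp add: distrib_right add.commute flip: uexp_add)
  with Suc show ?case by (simp add: distrib_right del: of_nat_Suc) (simp add: algebra_simps)
qed simp

section \<open>Hadamard pairs of digit sets\<close>

text \<open>The integral form of a Hadamard system, with the normalisation cleared. Both orthogonality
relations are kept, as this makes the notion symmetric and easy to compose.\<close>

definition hadamard_nat :: "nat \<Rightarrow> nat set \<Rightarrow> nat set \<Rightarrow> bool" where
  "hadamard_nat R A L \<longleftrightarrow> card A = card L \<and>
     (\<forall>a\<in>A. \<forall>a'\<in>A. a \<noteq> a' \<longrightarrow> (\<Sum>l\<in>L. uexp ((real a - real a') * real l / real R)) = 0) \<and>
     (\<forall>l\<in>L. \<forall>l'\<in>L. l \<noteq> l' \<longrightarrow> (\<Sum>a\<in>A. uexp ((real l - real l') * real a / real R)) = 0)"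

lemma hadamard_nat_commute: "hadamard_nat R A L \<longleftrightarrow> hadamard_nat R L A"
  unfolding hadamard_nat_def by auto

lemma hadamard_system_iff_nat:
  assumes fin: "finite A" "finite L" and ne: "A \<noteq> {}"
  shows "hadamard_system (real R) (real ` A) (real ` L) \<longleftrightarrow> hadamard_nat R A L"
proof -
  define N where "N = card A"
  have N: "N > 0" using fin ne by (simp add: N_def card_gt_0_iff)
  have cards: "card (real ` A) = N" "card (real ` L) = card L"
    by (simp_all add: card_image inj_on_of_nat N_def)
  define U where "U = (\<lambda>b l. 1 / complex_of_real (sqrt (real (card (real ` A)))) *
          exp (2 * complex_of_real pi * \<i> * complex_of_real (inverse (real R) * b * l)))"
  have U: "U b l = uexp (b * l / real R) / complex_of_real (sqrt (real N))" for b l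
    by (simp add: U_def cards uexp_def cis_conv_exp divide_inverse algebra_simps)
  have sq: "complex_of_real (sqrt (real N)) * complex_of_real (sqrt (real N)) = of_nat N"
    by (simp flip: of_real_mult)
  have UU: "U b l * cnj (U b' l') = uexp (b * l / real R - b' * l' / real R) / of_nat N" for b l b' l'
    by (simp add: U uexp_diff sq)
  have rows: "(\<Sum>l\<in>real ` L. U (real a) l * cnj (U (real a') l)) =
      (\<Sum>l\<in>L. uexp ((real a - real a') * real l / real R)) / of_nat N" for a a'
    by (simp add: sum.reindex inj_on_of_nat UU sum_divide_distrib algebra_simps diff_divide_distrib)
  have cols: "(\<Sum>b\<in>real ` A. cnj (U b (real l')) * U b (real l)) =
      (\<Sum>a\<in>A. uexp ((real l - real l') * real a / real R)) / of_nat N" for l l'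
    by (subst mult.commute)
      (simp add: sum.reindex inj_on_of_nat UU sum_divide_distrib algebra_simps diff_divide_distrib)
  have "hadamard_system (real R) (real ` A) (real ` L) \<longleftrightarrow> N = card L \<and> unitary_on (real ` A) (real ` L) U"
    unfolding hadamard_system_def U_def[symmetric] using fin by (simp add: cards)
  also have "\<dots> \<longleftrightarrow> hadamard_nat R A L"
  proof (cases "N = card L")
    case True
    have "unitary_on (real ` A) (real ` L) U \<longleftrightarrow>
       (\<forall>a\<in>A. \<forall>a'\<in>A. (\<Sum>l\<in>L. uexp ((real a - real a') * real l / real R)) / of_nat N = (if a = a' then 1 else 0)) \<and>
       (\<forall>l'\<in>L. \<forall>l\<in>L. (\<Sum>a\<in>A. uexp ((real l - real l') * real a / real R)) / of_nat N = (if l' = l then 1 else 0))"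
      unfolding unitary_on_def by (simp add: rows cols)
    also have "\<dots> \<longleftrightarrow> hadamard_nat R A L"
      unfolding hadamard_nat_def using True N by (auto simp: N_def)
    finally show ?thesis using True by simp
  next
    case False
    then show ?thesis by (simp add: hadamard_nat_def N_def)
  qed
  finally show ?thesis .
qed

text \<open>The discrete Fourier matrix: the sums are geometric.\<close>

lemma hadamard_nat_fourier:
  assumes "0 < m"
  shows "hadamard_nat m {0..<m} {0..<m}"
proof -
  have "(\<Sum>l\<in>{0..<m}. uexp ((real a - real a') * real l / real m)) = 0"
    if a: "a < m" "a' < m" "a \<noteq> a'" for a a'
  proof -
    define t where "t = (real a - real a') / real m"
    have "(\<Sum>l\<in>{0..<m}. uexp ((real a - real a') * real l / real m)) = (\<Sum>l\<in>{0..<m}. uexp (real l * t))"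
      by (simp add: t_def mult.commute)
    moreover have "real m * t = of_int (int a - int a')" using assms by (simp add: t_def)
    then have "uexp (real m * t) = 1" by (metis Ints_of_int uexp_eq_1_iff)
    moreover have "uexp t \<noteq> 1"
    proof
      assume "uexp t = 1"
      then obtain k :: int where k: "t = of_int k" by (auto simp: uexp_eq_1_iff elim: Ints_cases)
      have "\<bar>real a - real a'\<bar> < real m" using a(1,2) by linarith
      then have "\<bar>t\<bar> < 1" "t \<noteq> 0" using a(3) assms by (simp_all add: t_def abs_divide)
      with k show False by auto
    qed
    ultimately show ?thesis using sum_uexp_geometric[where t = t and m = m] by simp
  qed
  then show ?thesis by (simp add: hadamard_nat_def)
qed

lemma hadamard_nat_trivial: "hadamard_nat m {0} {0}"
  by (simp add: hadamard_nat_def)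

text \<open>With \<open>a = r + m b\<close> and \<open>l + n j\<close> the phase of \<open>a (l + n j) / (m n)\<close> is
\<open>r l / (m n) + b l / n + r j / m\<close> up to an integer. If \<open>r \<noteq> r'\<close> the inner sum over \<open>j\<close> vanishes,
and if \<open>r = r'\<close> the sum over \<open>l\<close> does.\<close>

lemma hadamard_digit_comb_rows:
  assumes PQ: "hadamard_nat m P Q" and BM: "hadamard_nat n B M"
    and pos: "0 < m" "0 < n" and P: "P \<subseteq> {0..<m}" and M: "M \<subseteq> {0..<n}"
    and a: "a \<in> digit_comb m P B" "a' \<in> digit_comb m P B" "a \<noteq> a'"
  shows "(\<Sum>l\<in>digit_comb n M Q. uexp ((real a - real a') * real l / real (m * n))) = 0"
proof -
  obtain r b r' b' where *: "r \<in> P" "b \<in> B" "a = r + m * b" "r' \<in> P" "b' \<in> B" "a' = r' + m * b'"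
    using a by (auto simp: digit_comb_def)
  have phase: "uexp ((real a - real a') * real (l + n * j) / real (m * n)) =
      uexp ((real r - real r') * real l / real (m * n)) * uexp ((real b - real b') * real l / real n) *
      uexp ((real r - real r') * real j / real m)" for l j
  proof -
    have "(real a - real a') * real (l + n * j) / real (m * n) =
      (real r - real r') * real l / real (m * n) + (real b - real b') * real l / real n +
      (real r - real r') * real j / real m + of_int ((int b - int b') * int j)"
      using pos by (simp add: * field_simps)
    moreover have "uexp (of_int ((int b - int b') * int j)) = 1" by (simp only: uexp_eq_1_iff Ints_of_int)
    ultimately show ?thesis by (simp only: uexp_add mult_1_right)
  qed
  have "(\<Sum>l\<in>digit_comb n M Q. uexp ((real a - real a') * real l / real (m * n))) =
      (\<Sum>l\<in>M. uexp ((real r - real r') * real l / real (m * n)) * uexp ((real b - real b') * real l / real n) *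
        (\<Sum>j\<in>Q. uexp ((real r - real r') * real j / real m)))"
    unfolding sum_digit_comb[OF M] phase by (simp add: sum_distrib_left)
  also have "\<dots> = 0"
  proof (cases "r = r'")
    case True
    with * a(3) have "b \<noteq> b'" by auto
    then have "(\<Sum>l\<in>M. uexp ((real b - real b') * real l / real n)) = 0"
      using BM * by (simp add: hadamard_nat_def)
    then show ?thesis using True by (simp flip: sum_distrib_right)
  next
    case False
    then have "(\<Sum>j\<in>Q. uexp ((real r - real r') * real j / real m)) = 0"
      using PQ * by (simp add: hadamard_nat_def)
    then show ?thesis by simp
  qed
  finally show ?thesis .
qed

text \<open>The two factors enter symmetrically, so the columns follow from the rows after exchanging
\<open>(m, P, Q)\<close> and \<open>(n, M, B)\<close>.\<close>

lemma hadamard_digit_comb: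
  assumes PQ: "hadamard_nat m P Q" and BM: "hadamard_nat n B M"
    and pos: "0 < m" "0 < n" and P: "P \<subseteq> {0..<m}" and M: "M \<subseteq> {0..<n}"
  shows "hadamard_nat (m * n) (digit_comb m P B) (digit_comb n M Q)"
proof -
  have "card (digit_comb m P B) = card (digit_comb n M Q)"
    using PQ BM P M by (simp add: card_digit_comb hadamard_nat_def)
  then show ?thesis
    using hadamard_digit_comb_rows[OF PQ BM pos P M]
      hadamard_digit_comb_rows[OF BM[THEN hadamard_nat_commute[THEN iffD1]]
        PQ[THEN hadamard_nat_commute[THEN iffD1]] pos(2,1) M P]
    by (subst hadamard_nat_def) (auto simp: mult.commute)
qed

section \<open>Dual tilings\<close>

lemma picked_pair_commute: "picked_pair R A A' L L' \<Longrightarrow> picked_pair R A' A L' L"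
  unfolding picked_pair_def using direct_sum_commute by blast

text \<open>The inductive step for the dual sets. As \<open>Gcd A = 1\<close>, the bound for \<open>L\<close> is just \<open>L \<subseteq> {0..<R}\<close>;
for \<open>L' = M'\<close> both sides of the bound are multiplied by \<open>m\<close>.\<close>

lemma picked_pair_digit_comb:
  assumes R: "2 \<le> m" "0 < n" and d: "direct_sum B B' {0..<n}" and p: "picked_pair n B B' M M'"
    and one: "1 \<in> digit_comb m {0..<m} B"
  shows "picked_pair (m * n) (digit_comb m {0..<m} B) ((*) m ` B') (digit_comb n M {0..<m}) M'"
proof -
  have pp: "finite M" "finite M'" "M \<subseteq> {0..<n}" "M' \<subseteq> {0..<n}" "direct_sum M M' {0..<n}"
      "Gcd B' * Max M' < n"
    using p by (simp_all add: picked_pair_def)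
  have B: "B \<subseteq> {0..<n}" "B' \<subseteq> {0..<n}" using direct_sum_subset[OF d] R by auto
  then have finB: "finite B" "finite B'" by (auto intro: finite_subset)
  have neB: "B \<noteq> {}" "B' \<noteq> {}" using direct_sum_zero_mem[OF d] R by auto
  have had: "hadamard_nat n B M" "hadamard_nat n B' M'"
    using p hadamard_system_iff_nat finB neB by (auto simp: picked_pair_def)
  let ?A = "digit_comb m {0..<m} B" and ?L = "digit_comb n M {0..<m}"
  have Lsub: "?L \<subseteq> {0..<m * n}"
    using digit_comb_subset[OF pp(3), of "{0..<m}" m] by (simp add: mult.commute)
  have finA: "finite ?A" and finL: "finite ?L"
    using finB pp by (auto simp: digit_comb_def)
  have A: "hadamard_nat (m * n) ?A ?L"
    by (rule hadamard_digit_comb[OF hadamard_nat_fourier had(1)]) (use R pp in auto)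
  have A': "hadamard_nat (m * n) ((*) m ` B') M'"
    using hadamard_digit_comb[OF hadamard_nat_trivial[of m] had(2)] R pp
    by (auto simp: digit_comb_zero_left digit_comb_zero_right)
  have "direct_sum {0..<m} {0} {0..<m}" by (rule direct_sumI) auto
  then have dL: "direct_sum ?L M' {0..<m * n}"
    using direct_sum_digit_comb[OF pp(5), of "{0..<m}" "{0}" "{0..<m}"] R
    by (simp add: digit_comb_interval digit_comb_zero_right mult.commute)
  have "?L \<noteq> {}" using direct_sum_zero_mem[OF dL] R by auto
  then have "Max ?L \<in> ?L" using finL by simp
  then have "Gcd ?A * Max ?L < m * n" using one Lsub by (auto simp: Gcd_1)
  moreover have "Gcd ((*) m ` B') * Max M' < m * n"
    using pp(6) R by (simp add: Gcd_mult mult.assoc)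
  moreover have "M' \<subseteq> {0..<m * n}"
    using pp(4) R by (force intro: less_le_trans)
  moreover have "?A \<noteq> {}" "(*) m ` B' \<noteq> {}" using one neB by auto
  ultimately show ?thesis
    unfolding picked_pair_def using A A' Lsub finA finB finL pp dL
    by (simp add: hadamard_system_iff_nat del: of_nat_mult)
qed

text \<open>The greatest common divisor of \<open>{0}\<close> is \<open>0\<close>, so divisibility can only be claimed for the other
sets; the bounds in \<open>picked_pair\<close> hold for \<open>{0}\<close> as well, which lets the induction pass through
trivial tilings.\<close>

theorem tiling_picked_pair:
  assumes "0 < R" "direct_sum A A' {0..<R}"
  shows "(A = {0} \<or> Gcd A dvd R) \<and> (A' = {0} \<or> Gcd A' dvd R) \<and> (\<exists>L L'. picked_pair R A A' L L')"
  using assms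
proof (induction R arbitrary: A A' rule: less_induct)
  case (less R)
  have one: "(A = {0} \<or> Gcd A dvd R) \<and> (A' = {0} \<or> Gcd A' dvd R) \<and> (\<exists>L L'. picked_pair R A A' L L')"
    if R: "2 \<le> R" and d: "direct_sum A A' {0..<R}" and one: "1 \<in> A" for A A'
  proof -
    obtain m n B B' where mn: "2 \<le> m" "R = m * n" and B: "direct_sum B B' {0..<n}"
      and A: "A = digit_comb m {0..<m} B" "A' = (*) m ` B'"
      using tiling_structure[OF d R one] .
    have n: "0 < n" "n < R" using mn R by (auto intro: Nat.gr0I)
    from less.IH[OF n(2,1) B] obtain M M' where IH: "B' = {0} \<or> Gcd B' dvd n" "picked_pair n B B' M M'"
      by blast
    have "picked_pair R A A' (digit_comb n M {0..<m}) M'"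
      unfolding mn A using picked_pair_digit_comb mn(1) n(1) B IH(2) one A by blast
    moreover have "Gcd A = 1" using one by (rule Gcd_1)
    moreover have "A' = {0} \<or> Gcd A' dvd R"
      using IH(1) by (auto simp: A mn Gcd_mult)
    ultimately show ?thesis by (metis one_dvd)
  qed
  show ?case
  proof (cases "R = 1")
    case True
    have "A = {0}" "A' = {0}"
      using direct_sum_subset[OF less.prems(2)] direct_sum_zero_mem[OF less.prems(2)] True by auto
    moreover have "picked_pair 1 {0} {0} {0} {0}"
      using hadamard_nat_trivial[of 1] hadamard_system_iff_nat[of "{0}" "{0}" 1]
      by (auto simp: picked_pair_def intro!: direct_sumI)
    ultimately show ?thesis using True by auto
  next
    case False
    then have R: "2 \<le> R" using less.prems by simp
    then have "1 \<in> {0..<R}" by simp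
    then obtain a a' where aa: "a \<in> A" "a' \<in> A'" "1 = a + a'" by (rule direct_sumE[OF less.prems(2)])
    then consider "1 \<in> A" | "1 \<in> A'" by (cases a) auto
    then show ?thesis
    proof cases
      case 1
      then show ?thesis using one[OF R less.prems(2)] by blast
    next
      case 2
      then show ?thesis
        using one[OF R direct_sum_commute[OF less.prems(2)]] picked_pair_commute by blast
    qed
  qed
qed

section \<open>Fourier transforms of measures on the line\<close>

definition fourier :: "real measure \<Rightarrow> real \<Rightarrow> complex" where
  "fourier \<mu> t = (LINT x|\<mu>. uexp (t * x))"

text \<open>The normalised exponential sum over the digits, known as the mask or low-pass filter of the
iterated function system.\<close>

definition mask :: "real set \<Rightarrow> real \<Rightarrow> complex" where
  "mask B t = (\<Sum>b\<in>B. uexp (b * t)) / of_nat (card B)"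

lemma fourier_eq_char: "fourier \<mu> t = char \<mu> (2 * pi * t)"
  by (simp add: fourier_def char_def uexp_def cis_conv_exp algebra_simps)

lemma borel_measurable_uexp [measurable]: "uexp \<in> borel_measurable borel"
  unfolding uexp_def cis_conv_exp by (intro borel_measurable_continuous_onI continuous_intros)

lemma norm_fourier_le_1: "real_distribution \<mu> \<Longrightarrow> norm (fourier \<mu> t) \<le> 1"
  by (simp add: fourier_eq_char real_distribution.cmod_char_le_1)

lemma fourier_0: "real_distribution \<mu> \<Longrightarrow> fourier \<mu> 0 = 1"
  by (simp add: fourier_eq_char real_distribution.char_zero)

lemma isCont_fourier: "real_distribution \<mu> \<Longrightarrow> isCont (fourier \<mu>) t"
  unfolding fourier_eq_char
  by (rule isCont_o2[where f = "\<lambda>t. 2 * pi * t"])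
    (auto intro!: continuous_intros real_distribution.isCont_char)

lemma fourier_unique:
  assumes "real_distribution \<mu>" "real_distribution \<nu>" "fourier \<mu> = fourier \<nu>"
  shows "\<mu> = \<nu>"
proof (rule Levy_uniqueness[OF assms(1,2)], rule ext)
  fix t
  show "char \<mu> t = char \<nu> t"
    using fun_cong[OF assms(3), of "t / (2 * pi)"] by (simp add: fourier_eq_char)
qed

lemma norm_mask_le_1: "norm (mask B t) \<le> 1"
proof (cases "card B = 0")
  case False
  have "norm (\<Sum>b\<in>B. uexp (b * t)) \<le> (\<Sum>b\<in>B. norm (uexp (b * t)))" by (rule norm_sum)
  then show ?thesis using False by (simp add: mask_def norm_divide divide_le_eq)
qed (simp add: mask_def)

section \<open>Invariance as a refinement equation\<close>

text \<open>The law of \<open>ifs_map R b (Y \<omega>)\<close> for a uniformly chosen digit \<open>b\<close> independent of \<open>\<omega>\<close>. The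
invariance equation says that this law is \<open>\<mu>\<close> when \<open>Y\<close> has law \<open>\<mu>\<close>; a general \<open>Y\<close> is allowed since
existence is shown with a random series.\<close>

definition ifs_average :: "nat \<Rightarrow> real set \<Rightarrow> 'a measure \<Rightarrow> ('a \<Rightarrow> real) \<Rightarrow> real measure" where
  "ifs_average R B N Y =
     distr (uniform_count_measure B \<Otimes>\<^sub>M N) borel (\<lambda>(b, \<omega>). ifs_map R b (Y \<omega>))"

lemma borel_measurable_fst_uniform_count_measure [measurable]:
  fixes B :: "real set"
  shows "fst \<in> borel_measurable (uniform_count_measure B \<Otimes>\<^sub>M N)"
proof -
  have "(\<lambda>b. b) \<in> borel_measurable (uniform_count_measure B)"
    by (simp add: uniform_count_measure_def)
  then show ?thesis by (rule measurable_compose[OF measurable_fst])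
qed

lemma measurable_ifs_average [measurable]:
  fixes B :: "real set"
  assumes [measurable]: "Y \<in> borel_measurable N"
  shows "(\<lambda>(b, \<omega>). ifs_map R b (Y \<omega>)) \<in> borel_measurable (uniform_count_measure B \<Otimes>\<^sub>M N)"
  unfolding ifs_map_def case_prod_beta by measurable

lemma integral_ifs_average:
  fixes f :: "real \<Rightarrow> 'b :: {banach, second_countable_topology}"
  assumes B: "finite B" "B \<noteq> {}" and N: "prob_space N" and Y[measurable]: "Y \<in> borel_measurable N"
    and f[measurable]: "f \<in> borel_measurable borel" and C: "\<And>x. norm (f x) \<le> C"
  shows "integral\<^sup>L (ifs_average R B N Y) f =
    (1 / real (card B)) *\<^sub>R (\<Sum>b\<in>B. LINT \<omega>|N. f (ifs_map R b (Y \<omega>)))"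
proof -
  interpret N: prob_space N by fact
  interpret U: prob_space "uniform_count_measure B" using prob_space_uniform_count_measure[OF B] .
  interpret P: pair_prob_space "uniform_count_measure B" N ..
  have int: "integrable (uniform_count_measure B \<Otimes>\<^sub>M N) (\<lambda>(b, \<omega>). f (ifs_map R b (Y \<omega>)))"
  proof (rule P.integrable_const_bound)
    show "AE x in uniform_count_measure B \<Otimes>\<^sub>M N. norm (case x of (b, \<omega>) \<Rightarrow> f (ifs_map R b (Y \<omega>))) \<le> C"
      using C by (simp add: case_prod_beta)
    show "(\<lambda>(b, \<omega>). f (ifs_map R b (Y \<omega>))) \<in> borel_measurable (uniform_count_measure B \<Otimes>\<^sub>M N)"
      using measurable_compose[OF measurable_ifs_average[OF Y] f] by (simp add: case_prod_beta)
  qed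
  have "integral\<^sup>L (ifs_average R B N Y) f =
      integral\<^sup>L (uniform_count_measure B \<Otimes>\<^sub>M N) (\<lambda>(b, \<omega>). f (ifs_map R b (Y \<omega>)))"
    unfolding ifs_average_def by (subst integral_distr) (simp_all add: case_prod_beta')
  also have "\<dots> = (LINT b|uniform_count_measure B. LINT \<omega>|N. f (ifs_map R b (Y \<omega>)))"
    using P.integral_fst'[OF int] by simp
  also have "\<dots> = (1 / real (card B)) *\<^sub>R (\<Sum>b\<in>B. LINT \<omega>|N. f (ifs_map R b (Y \<omega>)))"
    unfolding uniform_count_measure_def
    by (subst lebesgue_integral_point_measure_finite) (use B in \<open>auto simp: scaleR_sum_right\<close>)
  finally show ?thesis .
qed

lemma real_distribution_ifs_average:
  assumes B: "finite B" "B \<noteq> {}" and N: "prob_space N" and Y[measurable]: "Y \<in> borel_measurable N"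
  shows "real_distribution (ifs_average R B N Y)"
proof -
  interpret N: prob_space N by fact
  interpret U: prob_space "uniform_count_measure B" using prob_space_uniform_count_measure[OF B] .
  interpret P: pair_prob_space "uniform_count_measure B" N ..
  interpret D: prob_space "ifs_average R B N Y"
    unfolding ifs_average_def by (intro P.prob_space_distr measurable_ifs_average Y)
  show ?thesis by standard (simp_all add: ifs_average_def)
qed

lemma measure_ifs_average:
  assumes B: "finite B" "B \<noteq> {}" and N: "prob_space N" and Y[measurable]: "Y \<in> borel_measurable N"
    and E: "E \<in> sets borel"
  shows "measure (ifs_average R B N Y) E =
    1 / real (card B) * (\<Sum>b\<in>B. measure (distr N borel Y) (ifs_map R b -` E))"
proof -
  interpret N: prob_space N by fact
  interpret D: real_distribution "ifs_average R B N Y"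
    by (rule real_distribution_ifs_average) fact+
  have [measurable]: "ifs_map R b \<in> borel_measurable borel" for b
    unfolding ifs_map_def by measurable
  have "(LINT \<omega>|N. indicator E (ifs_map R b (Y \<omega>)) :: real) = measure (distr N borel Y) (ifs_map R b -` E)" for b
  proof -
    have "ifs_map R b -` E \<in> sets borel" using measurable_sets[of "ifs_map R b" borel borel E] E by simp
    moreover have "(indicator E (ifs_map R b (Y \<omega>)) :: real) = indicator (Y -` (ifs_map R b -` E)) \<omega>" for \<omega>
      by (simp add: indicator_def)
    ultimately show ?thesis
      by (simp add: measure_distr Int_commute)
  qed
  moreover have "measure (ifs_average R B N Y) E = integral\<^sup>L (ifs_average R B N Y) (indicator E)"
    by simp
  ultimately show ?thesis
    using integral_ifs_average[OF B N Y, of "indicator E :: real \<Rightarrow> real" 1] E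
    by (simp del: integral_indicator Bochner_Integration.integral_indicator)
qed

lemma is_invariant_measure_iff:
  assumes B: "finite B" "B \<noteq> {}" and \<mu>: "real_distribution \<mu>"
  shows "is_invariant_measure R B \<mu> \<longleftrightarrow> ifs_average R B \<mu> (\<lambda>x. x) = \<mu>"
proof -
  interpret real_distribution \<mu> by fact
  interpret D: real_distribution "ifs_average R B \<mu> (\<lambda>x. x)"
    by (rule real_distribution_ifs_average) (use B prob_space_axioms in auto)
  have id: "distr \<mu> borel (\<lambda>x. x) = \<mu>" by (rule distr_id2) simp
  have m: "measure (ifs_average R B \<mu> (\<lambda>x. x)) E = 1 / real (card B) * (\<Sum>b\<in>B. measure \<mu> (ifs_map R b -` E))"
    if "E \<in> sets borel" for E
    using measure_ifs_average[OF B prob_space_axioms _ that, of "\<lambda>x. x" R] by (simp add: id)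
  show ?thesis
  proof
    assume inv: "is_invariant_measure R B \<mu>"
    show "ifs_average R B \<mu> (\<lambda>x. x) = \<mu>"
    proof (rule measure_eqI)
      fix E assume "E \<in> sets (ifs_average R B \<mu> (\<lambda>x. x))"
      then have "E \<in> sets borel" by simp
      then show "emeasure (ifs_average R B \<mu> (\<lambda>x. x)) E = emeasure \<mu> E"
        using m inv by (simp add: is_invariant_measure_def emeasure_eq_measure D.emeasure_eq_measure)
    qed simp
  next
    assume "ifs_average R B \<mu> (\<lambda>x. x) = \<mu>"
    then show "is_invariant_measure R B \<mu>"
      using m prob_space_axioms unfolding is_invariant_measure_def by auto
  qed
qed

lemma is_invariant_measure_real_distribution:
  "is_invariant_measure R B \<mu> \<Longrightarrow> real_distribution \<mu>"
  by (simp add: is_invariant_measure_def real_distribution_def real_distribution_axioms_def)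

lemma fourier_ifs_average:
  assumes B: "finite B" "B \<noteq> {}" and \<mu>: "real_distribution \<mu>"
  shows "fourier (ifs_average R B \<mu> (\<lambda>x. x)) t = mask B (t / real R) * fourier \<mu> (t / real R)"
proof -
  interpret real_distribution \<mu> by fact
  have "uexp (t * ifs_map R b x) = uexp (b * (t / real R)) * uexp (t / real R * x)" for b x
    unfolding uexp_add[symmetric] by (simp add: ifs_map_def algebra_simps divide_inverse)
  then have "fourier (ifs_average R B \<mu> (\<lambda>x. x)) t =
      (1 / real (card B)) *\<^sub>R (\<Sum>b\<in>B. uexp (b * (t / real R)) * fourier \<mu> (t / real R))"
    unfolding fourier_def
    by (subst integral_ifs_average[OF B prob_space_axioms, where C = 1]) auto
  also have "\<dots> = mask B (t / real R) * fourier \<mu> (t / real R)"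
    by (simp add: mask_def scaleR_conv_of_real flip: sum_distrib_right)
  finally show ?thesis .
qed

lemma fourier_invariant:
  assumes "finite B" "B \<noteq> {}" "is_invariant_measure R B \<mu>"
  shows "fourier \<mu> t = mask B (t / real R) * fourier \<mu> (t / real R)"
  using fourier_ifs_average[of B \<mu> R t] is_invariant_measure_iff[of B \<mu> R]
    is_invariant_measure_real_distribution[OF assms(3)] assms by simp

lemma tendsto_divide_power_0:
  assumes "2 \<le> R"
  shows "(\<lambda>n. t / real R ^ n) \<longlonglongrightarrow> 0"
proof -
  have "(\<lambda>n. t * (1 / real R) ^ n) \<longlonglongrightarrow> t * 0"
    using assms by (intro tendsto_mult tendsto_const LIMSEQ_power_zero) simp
  then show ?thesis by (simp add: power_one_over)
qed

text \<open>As \<open>p\<close> is bounded by \<open>1\<close>, the distance of two solutions at \<open>t\<close> is at most their distance at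
\<open>t / R ^ n\<close>, which tends to their distance at \<open>0\<close>.\<close>

lemma refinement_equation_unique:
  fixes \<phi> \<psi> p :: "real \<Rightarrow> complex"
  assumes R: "2 \<le> R" and p: "\<And>t. norm (p t) \<le> 1"
    and \<phi>: "\<And>t. \<phi> t = p (t / real R) * \<phi> (t / real R)" "isCont \<phi> 0"
    and \<psi>: "\<And>t. \<psi> t = p (t / real R) * \<psi> (t / real R)" "isCont \<psi> 0"
    and eq: "\<phi> 0 = \<psi> 0"
  shows "\<phi> = \<psi>"
proof
  fix t
  have step: "norm (\<phi> t - \<psi> t) \<le> norm (\<phi> (t / real R) - \<psi> (t / real R))" for t
  proof -
    have "\<phi> t - \<psi> t = p (t / real R) * (\<phi> (t / real R) - \<psi> (t / real R))"
      using \<phi>(1)[of t] \<psi>(1)[of t] by (simp add: algebra_simps)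
    then show ?thesis using mult_right_mono[OF p norm_ge_zero] by (simp add: norm_mult)
  qed
  have le: "norm (\<phi> t - \<psi> t) \<le> norm (\<phi> (t / real R ^ n) - \<psi> (t / real R ^ n))" for n
  proof (induction n)
    case (Suc n)
    then show ?case using step[of "t / real R ^ n"] by (simp add: mult.commute)
  qed simp
  have lim: "(\<lambda>n. norm (\<phi> (t / real R ^ n) - \<psi> (t / real R ^ n))) \<longlonglongrightarrow> norm (\<phi> 0 - \<psi> 0)"
    by (intro tendsto_norm tendsto_diff isCont_tendsto_compose[OF \<phi>(2)] isCont_tendsto_compose[OF \<psi>(2)]
        tendsto_divide_power_0 R)
  have "norm (\<phi> t - \<psi> t) \<le> norm (\<phi> 0 - \<psi> 0)"
    by (rule Lim_bounded2[OF lim]) (use le in auto)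
  then show "\<phi> t = \<psi> t" using eq by simp
qed

lemma invariant_measure_unique:
  assumes R: "2 \<le> R" and B: "finite B" "B \<noteq> {}"
    and "is_invariant_measure R B \<mu>" "is_invariant_measure R B \<nu>"
  shows "\<mu> = \<nu>"
proof -
  note rd = assms(4,5)[THEN is_invariant_measure_real_distribution]
  show ?thesis
  proof (rule fourier_unique[OF rd])
    show "fourier \<mu> = fourier \<nu>"
      using rd by (intro refinement_equation_unique[where p = "mask B", OF R norm_mask_le_1]
          fourier_invariant[OF B] assms(4,5) isCont_fourier) (simp_all add: fourier_0)
  qed
qed

section \<open>Existence of the invariant measure\<close>

text \<open>The law of \<open>\<Sum>k. \<omega> k / R ^ Suc k\<close> with independent uniform digits \<open>\<omega> k\<close> is invariant, because
prepending a digit to the sequence preserves its law and acts on the series as the corresponding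
map of the system. The series takes values in \<open>[0,1]\<close> as it is dominated by the expansion
of \<open>1\<close> in base \<open>R\<close>.\<close>

lemma ex_invariant_measure:
  assumes R: "2 \<le> R" and B: "finite B" "B \<noteq> {}" "B \<subseteq> {0..real R - 1}"
  shows "\<exists>\<mu>. is_invariant_measure R B \<mu> \<and> (AE x in \<mu>. x \<in> {0..1})"
proof -
  define U where "U = uniform_count_measure B"
  interpret U: prob_space U unfolding U_def using prob_space_uniform_count_measure[OF B(1,2)] .
  interpret seq: sequence_space U ..
  define X where "X = (\<lambda>\<omega>. \<Sum>k. \<omega> k / real R ^ Suc k)"
  have space: "space seq.S = {\<omega>. \<forall>k. \<omega> k \<in> B}"
    by (auto simp: space_PiM PiE_iff U_def space_uniform_count_measure)
  have geo: "(\<lambda>k. (real R - 1) / real R ^ Suc k) sums 1"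
  proof -
    have "(\<lambda>k. (real R - 1) / real R * (1 / real R) ^ k) sums ((real R - 1) / real R * (1 / (1 - 1 / real R)))"
      using R by (intro sums_mult geometric_sums) simp
    moreover have "(real R - 1) / real R * (1 / (1 - 1 / real R)) = 1"
    proof -
      have "real R \<noteq> 0" "real R - 1 \<noteq> 0" using R by auto
      then show ?thesis by (simp add: field_simps)
    qed
    ultimately have "(\<lambda>k. (real R - 1) / real R * (1 / real R) ^ k) sums 1" by (simp only:)
    then show ?thesis by (simp add: power_one_over)
  qed
  have digit: "0 \<le> \<omega> k / real R ^ Suc k" "\<omega> k / real R ^ Suc k \<le> (real R - 1) / real R ^ Suc k"
    if "\<omega> \<in> space seq.S" for \<omega> k
  proof -
    have "\<omega> k \<in> {0..real R - 1}" using that B(3) unfolding space by blast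
    then show "0 \<le> \<omega> k / real R ^ Suc k" "\<omega> k / real R ^ Suc k \<le> (real R - 1) / real R ^ Suc k"
      by (auto intro!: divide_right_mono divide_nonneg_nonneg)
  qed
  have summable: "summable (\<lambda>k. \<omega> k / real R ^ Suc k)" if "\<omega> \<in> space seq.S" for \<omega>
    by (rule summable_comparison_test'[OF sums_summable[OF geo], of 0]) (simp only: real_norm_def abs_of_nonneg[OF digit(1)[OF that]] digit(2)[OF that])
  have X01: "X \<omega> \<in> {0..1}" if "\<omega> \<in> space seq.S" for \<omega>
    using suminf_nonneg[OF summable[OF that] digit(1)[OF that]]
      suminf_le[OF digit(2)[OF that] summable[OF that] sums_summable[OF geo]] sums_unique[OF geo]
    by (simp only: X_def atLeastAtMost_iff simp_thms)
  have X_cons: "X (case_nat b \<omega>) = ifs_map R b (X \<omega>)" if "b \<in> B" "\<omega> \<in> space seq.S" for b \<omega>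
  proof -
    have "case_nat b \<omega> \<in> space seq.S" using that by (auto simp: space split: nat.split)
    from suminf_split_head[OF summable[OF this]]
    have "X (case_nat b \<omega>) = b / real R + (\<Sum>k. \<omega> k / real R ^ Suc (Suc k))"
      by (simp add: X_def)
    also have "(\<lambda>k. \<omega> k / real R ^ Suc (Suc k)) = (\<lambda>k. inverse (real R) * (\<omega> k / real R ^ Suc k))"
      by (auto simp: field_simps)
    also have "(\<Sum>k. inverse (real R) * (\<omega> k / real R ^ Suc k)) = inverse (real R) * X \<omega>"
      unfolding X_def by (rule suminf_mult[OF summable[OF that(2)]])
    finally show ?thesis by (simp add: ifs_map_def add_divide_distrib divide_inverse algebra_simps)
  qed
  have coord: "(\<lambda>\<omega>. \<omega> k) \<in> borel_measurable seq.S" for k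
  proof -
    have "(\<lambda>b. b) \<in> borel_measurable U" by (simp add: U_def uniform_count_measure_def)
    from measurable_compose[OF measurable_component_singleton[of k UNIV "\<lambda>_. U"] this] show ?thesis by simp
  qed
  have X[measurable]: "X \<in> borel_measurable seq.S"
    unfolding X_def by (intro borel_measurable_suminf borel_measurable_divide coord borel_measurable_const)
  define \<mu> where "\<mu> = distr seq.S borel X"
  interpret \<mu>: prob_space \<mu> unfolding \<mu>_def by (rule seq.P.prob_space_distr) simp
  have rd: "real_distribution \<mu>" by standard (simp_all add: \<mu>_def)
  have shift: "(\<lambda>(b, \<omega>). case_nat b \<omega>) \<in> measurable (U \<Otimes>\<^sub>M seq.S) seq.S" by measurable
  have "\<mu> = distr (distr (U \<Otimes>\<^sub>M seq.S) seq.S (\<lambda>(b, \<omega>). case_nat b \<omega>)) borel X"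
    by (simp add: \<mu>_def seq.PiM_iter)
  also have "\<dots> = distr (U \<Otimes>\<^sub>M seq.S) borel (X \<circ> (\<lambda>(b, \<omega>). case_nat b \<omega>))"
    by (rule distr_distr[OF X shift])
  also have "\<dots> = ifs_average R B seq.S X"
    unfolding ifs_average_def U_def[symmetric]
    by (rule distr_cong) (auto simp: space_pair_measure X_cons U_def space_uniform_count_measure)
  finally have \<mu>: "\<mu> = ifs_average R B seq.S X" .
  have "is_invariant_measure R B \<mu>"
    unfolding is_invariant_measure_def
  proof (intro conjI ballI)
    fix E :: "real set" assume "E \<in> sets borel"
    from measure_ifs_average[OF B(1,2) seq.P.prob_space_axioms X this, of R]
    show "measure \<mu> E = 1 / real (card B) * (\<Sum>b\<in>B. measure \<mu> (ifs_map R b -` E))"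
      unfolding \<mu>[symmetric] by (simp add: \<mu>_def)
  qed (use \<mu>.prob_space_axioms in \<open>simp_all add: \<mu>_def\<close>)
  moreover have "AE x in \<mu>. x \<in> {0..1}"
    unfolding \<mu>_def by (subst AE_distr_iff) (use X01 in auto)
  ultimately show ?thesis by blast
qed

lemma invariant_measure_props:
  assumes R: "2 \<le> R" and B: "finite B" "B \<noteq> {}" "B \<subseteq> {0..real R - 1}"
  shows "is_invariant_measure R B (invariant_measure R B)"
    and "AE x in invariant_measure R B. x \<in> {0..1}"
proof -
  obtain \<mu> where \<mu>: "is_invariant_measure R B \<mu>" "AE x in \<mu>. x \<in> {0..1}"
    using ex_invariant_measure[OF assms] by blast
  then have "invariant_measure R B = \<mu>"
    unfolding invariant_measure_def
    using invariant_measure_unique[OF R B(1,2)] by blast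
  then show "is_invariant_measure R B (invariant_measure R B)"
    and "AE x in invariant_measure R B. x \<in> {0..1}" by (simp_all only: \<mu>)
qed

lemma invariant_measure_tile:
  assumes R: "2 \<le> R" and B: "B \<subseteq> {0..<R}" "0 \<in> B"
  shows "is_invariant_measure R (real ` B) (invariant_measure R (real ` B))"
    and "AE x in invariant_measure R (real ` B). x \<in> {0..1}"
proof -
  have "real ` B \<subseteq> {0..real R - 1}"
  proof
    fix x assume "x \<in> real ` B"
    then obtain b where "x = real b" "b \<in> B" by blast
    moreover from this have "b < R" using B(1) by auto
    ultimately show "x \<in> {0..real R - 1}" by auto
  qed
  moreover have "finite B" using B(1) by (rule finite_subset) simp
  ultimately show "is_invariant_measure R (real ` B) (invariant_measure R (real ` B))"
    and "AE x in invariant_measure R (real ` B). x \<in> {0..1}"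
    using invariant_measure_props[OF R, of "real ` B"] B by auto
qed

section \<open>The convolution of the two invariant measures\<close>

lemma mask_image:
  "mask (real ` A) t = (\<Sum>a\<in>A. uexp (real a * t)) / of_nat (card A)"
  by (simp add: mask_def sum.reindex inj_on_of_nat card_image)

lemma mask_0: "finite B \<Longrightarrow> B \<noteq> {} \<Longrightarrow> mask B 0 = 1"
  by (simp add: mask_def)

text \<open>The product of two exponential sums runs over all sums \<open>a + a'\<close>, each of which represents a
different element of \<open>C\<close>.\<close>

lemma mask_mult_direct_sum:
  assumes "direct_sum A A' C"
  shows "mask (real ` A) t * mask (real ` A') t = mask (real ` C) t"
proof -
  have "(\<Sum>a\<in>A. uexp (real a * t)) * (\<Sum>a'\<in>A'. uexp (real a' * t)) =
      (\<Sum>p\<in>A \<times> A'. uexp (real (case p of (a, a') \<Rightarrow> a + a') * t))"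
    by (simp add: sum_product sum.cartesian_product distrib_right uexp_add case_prod_beta)
  also have "\<dots> = (\<Sum>c\<in>C. uexp (real c * t))"
    by (rule sum.reindex_bij_betw) (use assms in \<open>simp add: direct_sum_iff_bij_betw\<close>)
  finally show ?thesis
    using direct_sum_card[OF assms] by (simp add: mask_image flip: of_nat_mult)
qed

abbreviation unit_lebesgue :: "real measure" where
  "unit_lebesgue \<equiv> density lborel (indicator {0..1})"

lemma real_distribution_unit_lebesgue: "real_distribution unit_lebesgue"
proof -
  have "emeasure unit_lebesgue (space unit_lebesgue) = 1" by (simp add: emeasure_density)
  then interpret prob_space unit_lebesgue by (rule prob_spaceI)
  show ?thesis by standard simp
qed

text \<open>Stated without division, so that it covers \<open>t = 0\<close>.\<close>

lemma fourier_unit_lebesgue: "fourier unit_lebesgue t * (2 * pi * \<i> * t) = uexp t - 1"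
proof (cases "t = 0")
  case False
  define c where "c = 2 * complex_of_real pi * \<i> * complex_of_real t"
  have c: "c \<noteq> 0" using False by (simp add: c_def)
  have u: "uexp (t * x) = exp (c * of_real x)" for x
    by (simp add: uexp_def cis_conv_exp c_def algebra_simps)
  have "fourier unit_lebesgue t = (LINT x|density lborel (\<lambda>x. ennreal (indicator {0..1} x)). uexp (t * x))"
    by (simp add: fourier_def ennreal_indicator)
  also have "\<dots> = (LINT x|lborel. indicator {0..1} x *\<^sub>R uexp (t * x))"
    by (rule integral_density) auto
  also have "\<dots> = uexp (t * 1) / c - uexp (t * 0) / c"
  proof (rule integral_FTC_atLeastAtMost)
    fix x :: real assume "0 \<le> x" "x \<le> 1"
    have "((\<lambda>x. exp (c * x) / c) has_field_derivative exp (c * of_real x)) (at (of_real x))"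
      using c by (auto intro!: derivative_eq_intros)
    from has_vector_derivative_real_field[OF this]
    show "((\<lambda>x. uexp (t * x) / c) has_vector_derivative uexp (t * x)) (at x within {0..1})"
      unfolding u by (rule has_vector_derivative_at_within)
  next
    show "continuous_on {0..1} (\<lambda>x. uexp (t * x))" unfolding u by (intro continuous_intros)
  qed simp
  finally show ?thesis using c by (simp add: c_def field_simps)
qed simp

lemma fourier_unit_lebesgue_nonzero:
  assumes "\<bar>t\<bar> < 1"
  shows "fourier unit_lebesgue t \<noteq> 0"
proof (cases "t = 0")
  case True
  then show ?thesis using fourier_0[OF real_distribution_unit_lebesgue] by simp
next
  case False
  have "t \<notin> \<int>" using assms False by (auto elim!: Ints_cases)
  then have "uexp t \<noteq> 1" by (simp add: uexp_eq_1_iff)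
  then show ?thesis using fourier_unit_lebesgue[of t] by auto
qed

text \<open>Lebesgue measure on \<open>[0,1]\<close> is the invariant measure for the full digit set; on the Fourier side
this is the geometric sum.\<close>

lemma fourier_unit_lebesgue_refinement:
  assumes R: "0 < R"
  shows "fourier unit_lebesgue t =
    mask (real ` {0..<R}) (t / real R) * fourier unit_lebesgue (t / real R)"
proof (cases "t = 0")
  case True
  then show ?thesis using R by (simp add: mask_0)
next
  case False
  define c where "c = complex_of_real (2 * pi) * \<i> * of_real t"
  have c: "c \<noteq> 0" using False by (simp add: c_def)
  have R0: "complex_of_nat R \<noteq> 0" using R by simp
  define S where "S = (\<Sum>r\<in>{0..<R}. uexp (real r * (t / real R)))"
  have m: "mask (real ` {0..<R}) (t / real R) = S / of_nat R"
    unfolding mask_image S_def by simp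
  have "S * (uexp (t / real R) - 1) = uexp t - 1"
    using sum_uexp_geometric[where m = R and t = "t / real R"] R by (simp add: S_def)
  moreover have "uexp (t / real R) - 1 = fourier unit_lebesgue (t / real R) * c / of_nat R"
    using fourier_unit_lebesgue[of "t / real R"] by (simp add: c_def algebra_simps)
  moreover have "uexp t - 1 = fourier unit_lebesgue t * c"
    using fourier_unit_lebesgue[of t] by (simp add: c_def algebra_simps)
  ultimately have "(S / of_nat R * fourier unit_lebesgue (t / real R)) * c = fourier unit_lebesgue t * c"
    by (simp add: algebra_simps)
  then show ?thesis unfolding m mult_right_cancel[OF c] by simp
qed

lemma real_distribution_convolution:
  assumes "real_distribution \<mu>" "real_distribution \<nu>"
  shows "real_distribution (convolution \<mu> \<nu>)"
proof -
  interpret M: real_distribution \<mu> by fact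
  interpret N: real_distribution \<nu> by fact
  interpret P: pair_prob_space \<mu> \<nu> ..
  interpret D: prob_space "convolution \<mu> \<nu>"
    unfolding convolution_def by (rule P.prob_space_distr) simp
  show ?thesis by standard simp
qed

lemma fourier_convolution:
  assumes "real_distribution \<mu>" "real_distribution \<nu>"
  shows "fourier (convolution \<mu> \<nu>) t = fourier \<mu> t * fourier \<nu> t"
proof -
  interpret M: real_distribution \<mu> by fact
  interpret N: real_distribution \<nu> by fact
  interpret P: pair_prob_space \<mu> \<nu> ..
  have meas: "(\<lambda>(x, y). uexp (t * x) * uexp (t * y)) \<in> borel_measurable (\<mu> \<Otimes>\<^sub>M \<nu>)"
    by measurable
  have int: "integrable (\<mu> \<Otimes>\<^sub>M \<nu>) (\<lambda>(x, y). uexp (t * x) * uexp (t * y))"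
    by (rule P.integrable_const_bound[OF _ meas, of 1]) (auto simp: norm_mult)
  have "fourier (convolution \<mu> \<nu>) t = integral\<^sup>L (\<mu> \<Otimes>\<^sub>M \<nu>) (\<lambda>(x, y). uexp (t * x) * uexp (t * y))"
    unfolding fourier_def convolution_def
    by (subst integral_distr) (simp_all add: case_prod_beta' distrib_left uexp_add)
  also have "\<dots> = (LINT x|\<mu>. LINT y|\<nu>. uexp (t * x) * uexp (t * y))"
    using P.integral_fst'[OF int] by simp
  also have "\<dots> = fourier \<mu> t * fourier \<nu> t"
    by (simp add: fourier_def)
  finally show ?thesis .
qed

theorem convolution_invariant_measures:
  assumes R: "2 \<le> R" and d: "direct_sum A A' {0..<R}"
    and \<mu>: "is_invariant_measure R (real ` A) \<mu>" and \<nu>: "is_invariant_measure R (real ` A') \<nu>"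
  shows "convolution \<mu> \<nu> = unit_lebesgue"
proof -
  note rd = \<mu>[THEN is_invariant_measure_real_distribution] \<nu>[THEN is_invariant_measure_real_distribution]
  have z: "0 \<in> {0..<R}" using R by simp
  have fin: "finite (real ` A)" "finite (real ` A')"
    using direct_sum_subset[OF d z] by (auto intro: finite_subset)
  have ne: "real ` A \<noteq> {}" "real ` A' \<noteq> {}" using direct_sum_zero_mem[OF d z] by auto
  note rdc = real_distribution_convolution[OF rd]
  have ref: "fourier (convolution \<mu> \<nu>) t =
      mask (real ` {0..<R}) (t / real R) * fourier (convolution \<mu> \<nu>) (t / real R)" for t
    using fourier_invariant[OF fin(1) ne(1) \<mu>, of t] fourier_invariant[OF fin(2) ne(2) \<nu>, of t]
    by (simp only: fourier_convolution[OF rd] flip: mask_mult_direct_sum[OF d]) (simp add: mult_ac)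
  have "fourier (convolution \<mu> \<nu>) = fourier unit_lebesgue"
  proof (rule refinement_equation_unique[where p = "mask (real ` {0..<R})", OF R norm_mask_le_1 ref])
    show "fourier unit_lebesgue t =
        mask (real ` {0..<R}) (t / real R) * fourier unit_lebesgue (t / real R)" for t
      using fourier_unit_lebesgue_refinement R by simp
    show "isCont (fourier (convolution \<mu> \<nu>)) 0" "isCont (fourier unit_lebesgue) 0"
      using isCont_fourier rdc real_distribution_unit_lebesgue by blast+
    show "fourier (convolution \<mu> \<nu>) 0 = fourier unit_lebesgue 0"
      using fourier_0 rdc real_distribution_unit_lebesgue by metis
  qed
  then show ?thesis by (rule fourier_unique[OF rdc real_distribution_unit_lebesgue])
qed

text \<open>The transform of \<open>\<mu>\<close> divides the one of Lebesgue measure on \<open>[0,1]\<close>, which has no zero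
in \<open>(-1,1)\<close>.\<close>

lemma fourier_invariant_nonzero:
  assumes R: "2 \<le> R" and d: "direct_sum A A' {0..<R}"
    and \<mu>: "is_invariant_measure R (real ` A) \<mu>" and \<nu>: "is_invariant_measure R (real ` A') \<nu>"
    and t: "\<bar>t\<bar> < 1"
  shows "fourier \<mu> t \<noteq> 0"
proof -
  have "fourier \<mu> t * fourier \<nu> t = fourier unit_lebesgue t"
    using convolution_invariant_measures[OF assms(1-4)] fourier_convolution
      \<mu>[THEN is_invariant_measure_real_distribution] \<nu>[THEN is_invariant_measure_real_distribution]
    by metis
  then show ?thesis using fourier_unit_lebesgue_nonzero[OF t] by auto
qed

section \<open>Digit expansions\<close>

text \<open>The expansions with \<open>n\<close> digits, built from the lowest digit upwards. This is the recursion along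
which the refinement equation is unrolled.\<close>

fun digit_trunc :: "nat \<Rightarrow> nat set \<Rightarrow> nat \<Rightarrow> nat set" where
  "digit_trunc R L 0 = {0}"
| "digit_trunc R L (Suc n) = digit_comb R L (digit_trunc R L n)"

lemma digit_trunc_Suc_eq:
  "digit_trunc R L (Suc n) = {\<Sum>k\<le>n. R ^ k * l k | l. \<forall>k\<le>n. l k \<in> L}"
proof (induction n)
  case 0
  have "L = {l 0 | l. l 0 \<in> L}"
  proof
    show "L \<subseteq> {l 0 | l. l 0 \<in> L}"
    proof
      fix x assume "x \<in> L"
      then show "x \<in> {l 0 | l. l 0 \<in> L}" by (intro CollectI exI[of _ "\<lambda>_. x"]) simp
    qed
  qed auto
  then show ?case by (simp add: digit_comb_zero_right)
next
  case (Suc n)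
  have split: "(\<Sum>k\<le>Suc n. R ^ k * l k) = l 0 + R * (\<Sum>k\<le>n. R ^ k * l (Suc k))" for l :: "nat \<Rightarrow> nat"
    by (simp only: sum.atMost_Suc_shift) (simp add: sum_distrib_left mult_ac)
  have "digit_trunc R L (Suc (Suc n)) = digit_comb R L {\<Sum>k\<le>n. R ^ k * l k | l. \<forall>k\<le>n. l k \<in> L}"
    by (simp only: digit_trunc.simps(2)[of R L "Suc n"] Suc)
  also have "\<dots> = {\<Sum>k\<le>Suc n. R ^ k * l k | l. \<forall>k\<le>Suc n. l k \<in> L}" (is "?X = ?Y")
  proof
    show "?X \<subseteq> ?Y"
    proof
      fix x assume "x \<in> ?X"
      then obtain d l where x: "d \<in> L" "\<forall>k\<le>n. l k \<in> L" "x = d + R * (\<Sum>k\<le>n. R ^ k * l k)"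
        by (auto simp: digit_comb_def)
      show "x \<in> ?Y"
        by (intro CollectI exI[of _ "case_nat d l"] conjI)
          (use x in \<open>auto simp: split simp del: sum.atMost_Suc split: nat.split\<close>)
    qed
    show "?Y \<subseteq> ?X"
    proof
      fix x assume "x \<in> ?Y"
      then obtain l where l: "\<forall>k\<le>Suc n. l k \<in> L" "x = (\<Sum>k\<le>Suc n. R ^ k * l k)" by blast
      have "(\<Sum>k\<le>n. R ^ k * l (Suc k)) \<in> {\<Sum>k\<le>n. R ^ k * l k | l. \<forall>k\<le>n. l k \<in> L}"
        using l(1) by (intro CollectI exI[of _ "\<lambda>k. l (Suc k)"]) auto
      then show "x \<in> ?X" unfolding l(2) split using l(1) by (intro digit_comb_mem) auto
    qed
  qed
  finally show ?case .
qed

lemma digit_trunc_mono_Suc: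
  assumes "0 \<in> L"
  shows "digit_trunc R L n \<subseteq> digit_trunc R L (Suc n)"
proof (induction n)
  case 0
  then show ?case using assms by (simp add: digit_comb_zero_right)
next
  case (Suc n)
  then show ?case unfolding digit_trunc.simps(2) digit_comb_def by blast
qed

lemma digit_trunc_mono: "0 \<in> L \<Longrightarrow> m \<le> n \<Longrightarrow> digit_trunc R L m \<subseteq> digit_trunc R L n"
  using lift_Suc_mono_le[of "digit_trunc R L" m n] digit_trunc_mono_Suc by blast

lemma digit_sums_eq_Union:
  assumes "0 \<in> L"
  shows "digit_sums R L = (\<Union>n. digit_trunc R L n)"
proof -
  have "digit_sums R L = (\<Union>n. digit_trunc R L (Suc n))"
    unfolding digit_trunc_Suc_eq digit_sums_def by blast
  also have "\<dots> = (\<Union>n. digit_trunc R L n)"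
    using digit_trunc_mono_Suc[OF assms] by blast
  finally show ?thesis .
qed

lemma digit_trunc_subset:
  assumes "L \<subseteq> {0..<R}"
  shows "digit_trunc R L n \<subseteq> {0..<R ^ n}"
proof (induction n)
  case (Suc n)
  then show ?case using digit_comb_subset[OF assms Suc.IH] by simp
qed simp

lemma direct_sum_digit_trunc:
  assumes "direct_sum L L' {0..<R}" "0 < R"
  shows "direct_sum (digit_trunc R L n) (digit_trunc R L' n) {0..<R ^ n}"
proof (induction n)
  case 0
  show ?case by (rule direct_sumI) auto
next
  case (Suc n)
  then show ?case
    using direct_sum_digit_comb[OF assms(1) Suc] digit_comb_interval[OF assms(2)] by simp
qed

text \<open>As both digit sets contain \<open>0\<close>, any finitely many expansions can be padded to a common length,
where the claim is \<open>direct_sum_digit_trunc\<close>.\<close>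

lemma direct_sum_digit_sums:
  assumes L: "direct_sum L L' {0..<R}" and R: "2 \<le> R"
  shows "direct_sum (digit_sums R L) (digit_sums R L') UNIV"
proof -
  have z: "0 \<in> L" "0 \<in> L'" using direct_sum_zero_mem[OF L] R by auto
  have D: "direct_sum (digit_trunc R L n) (digit_trunc R L' n) {0..<R ^ n}" for n
    using direct_sum_digit_trunc[OF L] R by simp
  show ?thesis
    unfolding digit_sums_eq_Union[OF z(1)] digit_sums_eq_Union[OF z(2)]
  proof (rule direct_sumI)
    fix k :: nat
    have "k < 2 ^ k" by (rule less_exp)
    also have "\<dots> \<le> R ^ k" using R by (intro power_mono) auto
    finally have "k \<in> {0..<R ^ k}" by simp
    then obtain a a' where "a \<in> digit_trunc R L k" "a' \<in> digit_trunc R L' k" "k = a + a'"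
      by (rule direct_sumE[OF D])
    then show "\<exists>a\<in>\<Union>n. digit_trunc R L n. \<exists>a'\<in>\<Union>n. digit_trunc R L' n. k = a + a'" by blast
  next
    fix a a' b b'
    assume "a \<in> (\<Union>n. digit_trunc R L n)" "a' \<in> (\<Union>n. digit_trunc R L' n)"
      "b \<in> (\<Union>n. digit_trunc R L n)" "b' \<in> (\<Union>n. digit_trunc R L' n)" and eq: "a + a' = b + b'"
    then obtain i j k l where ijkl: "a \<in> digit_trunc R L i" "a' \<in> digit_trunc R L' j"
      "b \<in> digit_trunc R L k" "b' \<in> digit_trunc R L' l" by blast
    define n where "n = i + j + k + l"
    have "a \<in> digit_trunc R L n" "a' \<in> digit_trunc R L' n" "b \<in> digit_trunc R L n" "b' \<in> digit_trunc R L' n"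
      using ijkl digit_trunc_mono[OF z(1)] digit_trunc_mono[OF z(2)] unfolding n_def
      by (meson le_add1 le_add2 order_trans subsetD)+
    then show "a = b \<and> a' = b'" using direct_sum_unique[OF D] eq by blast
  qed simp
qed

section \<open>Closed spans of square integrable functions\<close>

text \<open>A set of functions, not of classes modulo null sets, so that pointwise arguments apply. The
tolerance bounds the squared norm, which avoids square roots.\<close>

definition span_closure_L2 :: "'a measure \<Rightarrow> 'i set \<Rightarrow> ('i \<Rightarrow> 'a \<Rightarrow> complex) \<Rightarrow> ('a \<Rightarrow> complex) set" where
  "span_closure_L2 M I \<phi> = {f. square_integrable M f \<and>
     (\<forall>\<epsilon>>0. \<exists>F c. finite F \<and> F \<subseteq> I \<and> (LINT x|M. (norm (f x - (\<Sum>i\<in>F. c i * \<phi> i x)))\<^sup>2) < \<epsilon>)}"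

lemma norm_add_squared_le:
  fixes a b :: "'a :: real_normed_vector"
  shows "(norm (a + b))\<^sup>2 \<le> 2 * (norm a)\<^sup>2 + 2 * (norm b)\<^sup>2"
proof -
  have "(norm (a + b))\<^sup>2 \<le> (norm a + norm b)\<^sup>2" by (intro power_mono norm_triangle_ineq) simp
  also have "\<dots> \<le> 2 * (norm a)\<^sup>2 + 2 * (norm b)\<^sup>2"
    using zero_le_power2[of "norm a - norm b"] by (simp add: power2_eq_square algebra_simps)
  finally show ?thesis .
qed

lemma square_integrable_add:
  assumes "square_integrable M f" "square_integrable M g"
  shows "square_integrable M (\<lambda>x. f x + g x)"
proof -
  have [measurable]: "f \<in> borel_measurable M" "g \<in> borel_measurable M"
    using assms by (auto simp: square_integrable_def)
  have "integrable M (\<lambda>x. 2 * (norm (f x))\<^sup>2 + 2 * (norm (g x))\<^sup>2)"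
    using assms by (auto simp: square_integrable_def)
  then have "integrable M (\<lambda>x. (norm (f x + g x))\<^sup>2)"
    by (rule Bochner_Integration.integrable_bound) (auto simp: norm_add_squared_le)
  then show ?thesis by (simp add: square_integrable_def)
qed

lemma square_integrable_scale:
  assumes "square_integrable M f"
  shows "square_integrable M (\<lambda>x. c * f x)"
proof -
  have "(\<lambda>x. (norm (c * f x))\<^sup>2) = (\<lambda>x. (norm c)\<^sup>2 * (norm (f x))\<^sup>2)"
    by (simp add: norm_mult power_mult_distrib)
  then show ?thesis using assms by (auto simp: square_integrable_def)
qed

lemma square_integrable_diff:
  "square_integrable M f \<Longrightarrow> square_integrable M g \<Longrightarrow> square_integrable M (\<lambda>x. f x - g x)"
  using square_integrable_add[of M f "\<lambda>x. - 1 * g x"] square_integrable_scale[of M g "- 1"] by simp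

lemma square_integrable_sum:
  "(\<And>i. i \<in> F \<Longrightarrow> square_integrable M (f i)) \<Longrightarrow> square_integrable M (\<lambda>x. \<Sum>i\<in>F. f i x)"
proof (induction F rule: infinite_finite_induct)
  case (insert i F)
  then show ?case using square_integrable_add[of M "f i" "\<lambda>x. \<Sum>i\<in>F. f i x"] by simp
qed (simp_all add: square_integrable_def)

lemma square_integrable_lincomb:
  assumes "\<And>i. i \<in> I \<Longrightarrow> square_integrable M (\<phi> i)" "F \<subseteq> I"
  shows "square_integrable M (\<lambda>x. \<Sum>i\<in>F. c i * \<phi> i x)"
  using assms by (intro square_integrable_sum square_integrable_scale) auto

lemma integral_norm_add_squared_le:
  assumes "square_integrable M f" "square_integrable M g"
  shows "(LINT x|M. (norm (f x + g x))\<^sup>2) \<le> 2 * (LINT x|M. (norm (f x))\<^sup>2) + 2 * (LINT x|M. (norm (g x))\<^sup>2)"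
proof -
  have "(LINT x|M. (norm (f x + g x))\<^sup>2) \<le> (LINT x|M. 2 * (norm (f x))\<^sup>2 + 2 * (norm (g x))\<^sup>2)"
    using square_integrable_add[OF assms] assms
    by (intro integral_mono) (auto simp: square_integrable_def norm_add_squared_le)
  also have "\<dots> = 2 * (LINT x|M. (norm (f x))\<^sup>2) + 2 * (LINT x|M. (norm (g x))\<^sup>2)"
    using assms by (subst Bochner_Integration.integral_add) (auto simp: square_integrable_def)
  finally show ?thesis .
qed

lemma span_closure_L2_square_integrable: "f \<in> span_closure_L2 M I \<phi> \<Longrightarrow> square_integrable M f"
  by (simp add: span_closure_L2_def)

lemma span_closure_L2_approx:
  assumes \<phi>: "\<And>i. i \<in> I \<Longrightarrow> square_integrable M (\<phi> i)" and f: "square_integrable M f"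
    and approx: "\<And>\<epsilon>. 0 < \<epsilon> \<Longrightarrow> \<exists>g\<in>span_closure_L2 M I \<phi>. (LINT x|M. (norm (f x - g x))\<^sup>2) < \<epsilon>"
  shows "f \<in> span_closure_L2 M I \<phi>"
  unfolding span_closure_L2_def
proof (intro CollectI conjI f allI impI)
  fix \<epsilon> :: real assume "0 < \<epsilon>"
  then have \<epsilon>: "0 < \<epsilon> / 4" by simp
  obtain g where g: "g \<in> span_closure_L2 M I \<phi>" "(LINT x|M. (norm (f x - g x))\<^sup>2) < \<epsilon> / 4"
    using approx[OF \<epsilon>] by blast
  then obtain F c where F: "finite F" "F \<subseteq> I" "(LINT x|M. (norm (g x - (\<Sum>i\<in>F. c i * \<phi> i x)))\<^sup>2) < \<epsilon> / 4"
    using \<epsilon> unfolding span_closure_L2_def by blast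
  have "(LINT x|M. (norm (f x - (\<Sum>i\<in>F. c i * \<phi> i x)))\<^sup>2) =
      (LINT x|M. (norm ((f x - g x) + (g x - (\<Sum>i\<in>F. c i * \<phi> i x))))\<^sup>2)"
    by simp
  also have "\<dots> \<le> 2 * (LINT x|M. (norm (f x - g x))\<^sup>2) + 2 * (LINT x|M. (norm (g x - (\<Sum>i\<in>F. c i * \<phi> i x)))\<^sup>2)"
    by (intro integral_norm_add_squared_le square_integrable_diff f
        span_closure_L2_square_integrable[OF g(1)] square_integrable_lincomb[OF \<phi> F(2)])
  also have "\<dots> < \<epsilon>" using g F by simp
  finally show "\<exists>F c. finite F \<and> F \<subseteq> I \<and> (LINT x|M. (norm (f x - (\<Sum>i\<in>F. c i * \<phi> i x)))\<^sup>2) < \<epsilon>"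
    using F by blast
qed

lemma span_closure_L2_add:
  assumes \<phi>: "\<And>i. i \<in> I \<Longrightarrow> square_integrable M (\<phi> i)"
    and f: "f \<in> span_closure_L2 M I \<phi>" and g: "g \<in> span_closure_L2 M I \<phi>"
  shows "(\<lambda>x. f x + g x) \<in> span_closure_L2 M I \<phi>"
  unfolding span_closure_L2_def
proof (intro CollectI conjI allI impI)
  note sq = f[THEN span_closure_L2_square_integrable] g[THEN span_closure_L2_square_integrable]
  show "square_integrable M (\<lambda>x. f x + g x)" using sq by (rule square_integrable_add)
  fix \<epsilon> :: real assume "0 < \<epsilon>"
  then have \<epsilon>: "0 < \<epsilon> / 4" by simp
  obtain F c where F: "finite F" "F \<subseteq> I" "(LINT x|M. (norm (f x - (\<Sum>i\<in>F. c i * \<phi> i x)))\<^sup>2) < \<epsilon> / 4"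
    using f \<epsilon> unfolding span_closure_L2_def by blast
  obtain G d where G: "finite G" "G \<subseteq> I" "(LINT x|M. (norm (g x - (\<Sum>i\<in>G. d i * \<phi> i x)))\<^sup>2) < \<epsilon> / 4"
    using g \<epsilon> unfolding span_closure_L2_def by blast
  define b where "b = (\<lambda>i. (if i \<in> F then c i else 0) + (if i \<in> G then d i else 0))"
  have b: "(\<Sum>i\<in>F \<union> G. b i * \<phi> i x) = (\<Sum>i\<in>F. c i * \<phi> i x) + (\<Sum>i\<in>G. d i * \<phi> i x)" for x
  proof -
    have "(\<Sum>i\<in>F \<union> G. (if i \<in> F then c i else 0) * \<phi> i x) = (\<Sum>i\<in>F. c i * \<phi> i x)"
      using F(1) G(1) by (intro sum.mono_neutral_cong_right) auto
    moreover have "(\<Sum>i\<in>F \<union> G. (if i \<in> G then d i else 0) * \<phi> i x) = (\<Sum>i\<in>G. d i * \<phi> i x)"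
      using F(1) G(1) by (intro sum.mono_neutral_cong_right) auto
    ultimately show ?thesis by (simp add: b_def distrib_right sum.distrib)
  qed
  have "(LINT x|M. (norm (f x + g x - (\<Sum>i\<in>F \<union> G. b i * \<phi> i x)))\<^sup>2) =
     (LINT x|M. (norm ((f x - (\<Sum>i\<in>F. c i * \<phi> i x)) + (g x - (\<Sum>i\<in>G. d i * \<phi> i x))))\<^sup>2)"
    unfolding b by (simp add: algebra_simps)
  also have "\<dots> \<le> 2 * (LINT x|M. (norm (f x - (\<Sum>i\<in>F. c i * \<phi> i x)))\<^sup>2) +
      2 * (LINT x|M. (norm (g x - (\<Sum>i\<in>G. d i * \<phi> i x)))\<^sup>2)"
    by (intro integral_norm_add_squared_le square_integrable_diff sq
        square_integrable_lincomb[OF \<phi> F(2)] square_integrable_lincomb[OF \<phi> G(2)])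
  also have "\<dots> < \<epsilon>" using F G by simp
  finally show "\<exists>F c. finite F \<and> F \<subseteq> I \<and> (LINT x|M. (norm (f x + g x - (\<Sum>i\<in>F. c i * \<phi> i x)))\<^sup>2) < \<epsilon>"
    using F G by (intro exI[of _ "F \<union> G"] exI[of _ b]) auto
qed

lemma span_closure_L2_zero: "(\<lambda>x. 0) \<in> span_closure_L2 M I \<phi>"
  unfolding span_closure_L2_def
  by (auto simp: square_integrable_def intro!: exI[of _ "{}"])

lemma span_closure_L2_scale:
  assumes f: "f \<in> span_closure_L2 M I \<phi>"
  shows "(\<lambda>x. a * f x) \<in> span_closure_L2 M I \<phi>"
proof (cases "a = 0")
  case True
  then show ?thesis by (simp add: span_closure_L2_zero)
next
  case False
  show ?thesis unfolding span_closure_L2_def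
  proof (intro CollectI conjI allI impI)
    show "square_integrable M (\<lambda>x. a * f x)"
      using f[THEN span_closure_L2_square_integrable] by (rule square_integrable_scale)
    fix \<epsilon> :: real assume "0 < \<epsilon>"
    then have "0 < \<epsilon> / (norm a)\<^sup>2" using False by simp
    then obtain F c where F: "finite F" "F \<subseteq> I" "(LINT x|M. (norm (f x - (\<Sum>i\<in>F. c i * \<phi> i x)))\<^sup>2) < \<epsilon> / (norm a)\<^sup>2"
      using f unfolding span_closure_L2_def by blast
    have "(norm (a * f x - (\<Sum>i\<in>F. (a * c i) * \<phi> i x)))\<^sup>2 = (norm a)\<^sup>2 * (norm (f x - (\<Sum>i\<in>F. c i * \<phi> i x)))\<^sup>2" for x
      unfolding power_mult_distrib[symmetric] norm_mult[symmetric]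
      by (simp add: right_diff_distrib sum_distrib_left mult.assoc)
    then have "(LINT x|M. (norm (a * f x - (\<Sum>i\<in>F. (a * c i) * \<phi> i x)))\<^sup>2) < \<epsilon>"
      using F(3) False by (simp add: field_simps)
    then show "\<exists>F c. finite F \<and> F \<subseteq> I \<and> (LINT x|M. (norm (a * f x - (\<Sum>i\<in>F. c i * \<phi> i x)))\<^sup>2) < \<epsilon>"
      using F by (intro exI[of _ F] exI[of _ "\<lambda>i. a * c i"]) simp
  qed
qed

lemma span_closure_L2_sum:
  assumes \<phi>: "\<And>i. i \<in> I \<Longrightarrow> square_integrable M (\<phi> i)"
  shows "(\<And>j. j \<in> J \<Longrightarrow> f j \<in> span_closure_L2 M I \<phi>) \<Longrightarrow> (\<lambda>x. \<Sum>j\<in>J. f j x) \<in> span_closure_L2 M I \<phi>"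
proof (induction J rule: infinite_finite_induct)
  case (insert j J)
  then show ?case using span_closure_L2_add[where f = "f j" and g = "\<lambda>x. \<Sum>j\<in>J. f j x" and I = I and \<phi> = \<phi>, OF \<phi>] by simp
qed (simp_all add: span_closure_L2_zero)

text \<open>Dominated convergence with a square integrable bound \<open>w\<close> is convergence in \<open>L\<^sup>2\<close>; this turns
pointwise approximations into membership in the closure.\<close>

lemma span_closure_L2_dominated:
  assumes \<phi>: "\<And>i. i \<in> I \<Longrightarrow> square_integrable M (\<phi> i)"
    and fn: "\<And>n::nat. f n \<in> span_closure_L2 M I \<phi>"
    and lim: "\<And>x. x \<in> space M \<Longrightarrow> (\<lambda>n. f n x) \<longlonglongrightarrow> g x"
    and bound: "\<And>n x. x \<in> space M \<Longrightarrow> norm (f n x) \<le> w x"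
    and w: "w \<in> borel_measurable M" "integrable M (\<lambda>x. (w x)\<^sup>2)"
  shows "g \<in> span_closure_L2 M I \<phi>"
proof (rule span_closure_L2_approx[OF \<phi>])
  have fm[measurable]: "f n \<in> borel_measurable M" for n
    using fn[THEN span_closure_L2_square_integrable] by (simp add: square_integrable_def)
  have gm[measurable]: "g \<in> borel_measurable M"
    by (rule borel_measurable_LIMSEQ_metric[OF fm lim])
  note wm[measurable] = w(1)
  have gb: "norm (g x) \<le> w x" if "x \<in> space M" for x
    by (rule Lim_bounded[OF tendsto_norm[OF lim[OF that]], of 0]) (use bound[OF that] in auto)
  have "integrable M (\<lambda>x. (norm (g x))\<^sup>2)"
    by (rule Bochner_Integration.integrable_bound[OF w(2)])
      (auto intro!: AE_I2 power_mono gb)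
  then show g: "square_integrable M g" by (simp add: square_integrable_def)
  have "(\<lambda>n. LINT x|M. (norm (g x - f n x))\<^sup>2) \<longlonglongrightarrow> (LINT x|M. 0)"
  proof (rule integral_dominated_convergence)
    show "integrable M (\<lambda>x. 4 * (w x)\<^sup>2)" using w by simp
    show "AE x in M. (\<lambda>n. (norm (g x - f n x))\<^sup>2) \<longlonglongrightarrow> 0"
    proof (rule AE_I2)
      fix x assume x: "x \<in> space M"
      have "(\<lambda>n. (norm (g x - f n x))\<^sup>2) \<longlonglongrightarrow> (norm (g x - g x))\<^sup>2"
        by (intro tendsto_intros lim x)
      then show "(\<lambda>n. (norm (g x - f n x))\<^sup>2) \<longlonglongrightarrow> 0" by simp
    qed
    show "AE x in M. norm ((norm (g x - f n x))\<^sup>2) \<le> 4 * (w x)\<^sup>2" for n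
    proof (rule AE_I2)
      fix x assume x: "x \<in> space M"
      have "norm (g x - f n x) \<le> 2 * w x"
        using gb[OF x] bound[OF x, of n] norm_triangle_ineq4[of "g x" "f n x"] by linarith
      then have "(norm (g x - f n x))\<^sup>2 \<le> (2 * w x)\<^sup>2" by (intro power_mono) auto
      then show "norm ((norm (g x - f n x))\<^sup>2) \<le> 4 * (w x)\<^sup>2" by (simp add: power_mult_distrib)
    qed
  qed measurable
  then have lim0: "(\<lambda>n. LINT x|M. (norm (g x - f n x))\<^sup>2) \<longlonglongrightarrow> 0" by simp
  fix \<epsilon> :: real assume "0 < \<epsilon>"
  from order_tendstoD(2)[OF lim0 this] obtain n where "(LINT x|M. (norm (g x - f n x))\<^sup>2) < \<epsilon>"
    by (auto simp: eventually_sequentially)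
  then show "\<exists>h\<in>span_closure_L2 M I \<phi>. (LINT x|M. (norm (g x - h x))\<^sup>2) < \<epsilon>" using fn by blast
qed

section \<open>Density of the exponentials\<close>

text \<open>All real frequencies are allowed, not just those of a spectrum. The inductive form makes closure
under products and membership in a linear space immediate inductions.\<close>

inductive exp_poly :: "(real \<Rightarrow> complex) \<Rightarrow> bool" where
  monomial: "exp_poly (\<lambda>x. c * uexp (t * x))"
| add: "exp_poly f \<Longrightarrow> exp_poly g \<Longrightarrow> exp_poly (\<lambda>x. f x + g x)"

lemma exp_poly_mult:
  assumes "exp_poly f" "exp_poly g"
  shows "exp_poly (\<lambda>x. f x * g x)"
  using assms(1)
proof induction
  case (monomial c t)
  from assms(2) show ?case
  proof induction
    case (monomial d s)
    have "(\<lambda>x. c * uexp (t * x) * (d * uexp (s * x))) = (\<lambda>x. (c * d) * uexp ((t + s) * x))"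
      by (simp add: uexp_add distrib_right mult.assoc mult.left_commute)
    then show ?case using exp_poly.monomial by simp
  next
    case (add f g)
    then show ?case using exp_poly.add by (simp add: distrib_left)
  qed
next
  case (add f g)
  then show ?case using exp_poly.add by (simp add: distrib_right)
qed

lemma exp_poly_const: "exp_poly (\<lambda>x. c)"
  using exp_poly.monomial[of c 0] by simp

lemma continuous_on_uexp [continuous_intros]: "continuous_on S f \<Longrightarrow> continuous_on S (\<lambda>x. uexp (f x))"
  unfolding uexp_def cis_conv_exp by (intro continuous_intros)

lemma exp_poly_continuous: "exp_poly f \<Longrightarrow> continuous_on S f"
  by (induction rule: exp_poly.induct) (intro continuous_intros | assumption)+

lemma exp_poly_cos: "exp_poly (\<lambda>x. complex_of_real (cos (2 * pi * t * x)))"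
proof -
  have "complex_of_real (cos (2 * pi * t * x)) = 1 / 2 * uexp (t * x) + 1 / 2 * uexp (- t * x)" for x
    by (simp add: uexp_def complex_eq_iff mult.assoc)
  then show ?thesis
    using exp_poly.add[OF exp_poly.monomial[of "1 / 2" t] exp_poly.monomial[of "1 / 2" "- t"]] by simp
qed

text \<open>The Stone-Weierstrass theorem. With real frequencies allowed, \<open>x \<mapsto> cos (pi * x)\<close> is available, and
it is injective on \<open>[0,1]\<close>.\<close>

lemma exp_poly_dense:
  assumes h: "continuous_on {0..1} h" and \<epsilon>: "0 < \<epsilon>"
  shows "\<exists>g. exp_poly (\<lambda>x. complex_of_real (g x)) \<and> (\<forall>x\<in>{0..1}. \<bar>h x - g x\<bar> < \<epsilon>)"
proof -
  interpret function_ring_on "{g :: real \<Rightarrow> real. exp_poly (\<lambda>x. complex_of_real (g x))}" "{0..1}"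
  proof
    fix f :: "real \<Rightarrow> real" assume "f \<in> {g. exp_poly (\<lambda>x. complex_of_real (g x))}"
    then have "continuous_on {0..1} (\<lambda>x. Re (complex_of_real (f x)))"
      by (intro continuous_intros exp_poly_continuous) simp
    then show "continuous_on {0..1} f" by simp
  next
    fix x y :: real assume xy: "x \<in> {0..1}" "y \<in> {0..1}" "x \<noteq> y"
    have "cos (pi * x) \<noteq> cos (pi * y)"
      using xy cos_inj_pi[of "pi * x" "pi * y"] by (auto simp: mult_le_cancel_left1)
    then show "\<exists>f\<in>{g. exp_poly (\<lambda>x. complex_of_real (g x))}. f x \<noteq> f y"
      using exp_poly_cos[of "1 / 2"] by (intro bexI[of _ "\<lambda>x. cos (pi * x)"]) auto
  qed (auto simp: exp_poly.add exp_poly_mult exp_poly_const)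
  show ?thesis using Stone_Weierstrass_basic[OF h \<epsilon>] by blast
qed

text \<open>From exponentials to all of \<open>L\<^sup>2\<close>: continuous functions are uniform limits on the support,
half-lines are pointwise limits of continuous functions, Borel sets follow by Dynkin's
\<open>\<pi>\<close>-\<open>\<lambda>\<close> argument, and every square integrable function is a dominated limit of simple functions.\<close>

lemma span_closure_L2_total:
  assumes M: "real_distribution M" and supp: "AE x in M. x \<in> {0..1}"
    and \<phi>: "\<And>i. i \<in> I \<Longrightarrow> square_integrable M (\<phi> i)"
    and exp: "\<And>t. (\<lambda>x. uexp (t * x)) \<in> span_closure_L2 M I \<phi>"
    and f: "square_integrable M f"
  shows "f \<in> span_closure_L2 M I \<phi>"
proof -
  interpret real_distribution M by fact
  let ?V = "span_closure_L2 M I \<phi>"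
  have poly: "p \<in> ?V" if "exp_poly p" for p
    using that by induction (auto intro: span_closure_L2_scale span_closure_L2_add \<phi> exp)
  have cont: "(\<lambda>x. complex_of_real (h x)) \<in> ?V" if h: "continuous_on UNIV h" "\<And>x. \<bar>h x\<bar> \<le> 1" for h
  proof (rule span_closure_L2_approx[OF \<phi>])
    have hm[measurable]: "h \<in> borel_measurable borel" using h(1) by (rule borel_measurable_continuous_onI)
    have "integrable M (\<lambda>x. (h x)\<^sup>2)"
      by (rule integrable_const_bound[of _ 1]) (use h(2) in \<open>auto simp: abs_square_le_1\<close>)
    then show sqh: "square_integrable M (\<lambda>x. complex_of_real (h x))"
      by (simp add: square_integrable_def)
    fix \<epsilon> :: real assume \<epsilon>: "0 < \<epsilon>"
    define \<delta> where "\<delta> = sqrt (\<epsilon> / 2)"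
    have \<delta>: "0 < \<delta>" "\<delta>\<^sup>2 = \<epsilon> / 2" using \<epsilon> by (simp_all add: \<delta>_def)
    obtain g where g: "exp_poly (\<lambda>x. complex_of_real (g x))" "\<forall>x\<in>{0..1}. \<bar>h x - g x\<bar> < \<delta>"
      using exp_poly_dense[OF continuous_on_subset[OF h(1)] \<delta>(1)] by auto
    note gV = poly[OF g(1)]
    have "(LINT x|M. (norm (complex_of_real (h x) - complex_of_real (g x)))\<^sup>2) \<le> (LINT x|M. \<delta>\<^sup>2)"
    proof (rule integral_mono_AE)
      show "integrable M (\<lambda>x. (norm (complex_of_real (h x) - complex_of_real (g x)))\<^sup>2)"
        using square_integrable_diff[OF sqh span_closure_L2_square_integrable[OF gV]]
        by (simp add: square_integrable_def)
      show "AE x in M. (norm (complex_of_real (h x) - complex_of_real (g x)))\<^sup>2 \<le> \<delta>\<^sup>2"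
        using supp
      proof eventually_elim
        fix x :: real assume x: "x \<in> {0..1}"
        show "(norm (complex_of_real (h x) - complex_of_real (g x)))\<^sup>2 \<le> \<delta>\<^sup>2"
          using g(2)[rule_format, OF x] by (intro power_mono) (simp_all flip: of_real_diff)
      qed
    qed simp
    also have "\<dots> < \<epsilon>" using \<delta> \<epsilon> prob_space by simp
    finally show "\<exists>g\<in>?V. (LINT x|M. (norm (complex_of_real (h x) - g x))\<^sup>2) < \<epsilon>"
      using gV by (rule bexI)
  qed
  have atMost: "(\<lambda>x. complex_of_real (indicator {..a} x)) \<in> ?V" for a
  proof (rule span_closure_L2_dominated[OF \<phi>])
    \<comment> \<open>for positive \<open>n\<close> equal to \<open>1\<close> up to \<open>a\<close>, to \<open>0\<close> from \<open>a + 1 / n\<close> on, and affine in between\<close>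
    define h where "h = (\<lambda>(n::nat) x. max 0 (min 1 (1 - real n * (x - a))))"
    show "(\<lambda>x. complex_of_real (h n x)) \<in> ?V" for n
      by (rule cont) (auto simp: h_def intro!: continuous_intros)
    show "(\<lambda>n. complex_of_real (h n x)) \<longlonglongrightarrow> complex_of_real (indicator {..a} x)" for x
    proof (rule tendsto_of_real)
      show "(\<lambda>n. h n x) \<longlonglongrightarrow> indicator {..a} x"
      proof (cases "x \<le> a")
        case True
        then have "h n x = 1" for n by (auto simp: h_def min_def mult_nonneg_nonpos)
        then show ?thesis using True by simp
      next
        case False
        then obtain N :: nat where N: "1 / (x - a) < real N" using reals_Archimedean2 by blast
        have "h n x = 0" if "N \<le> n" for n
        proof -
          have "1 < real N * (x - a)" using N False by (simp add: field_simps)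
          also have "\<dots> \<le> real n * (x - a)" using that False by (intro mult_right_mono) auto
          finally show ?thesis by (simp add: h_def)
        qed
        then have "\<forall>\<^sub>F n in sequentially. h n x = 0" by (auto simp: eventually_sequentially)
        then show ?thesis using False by (simp add: tendsto_eventually)
      qed
    qed
    show "norm (complex_of_real (h n x)) \<le> 1" for n x by (simp add: h_def)
  qed auto
  have one: "(\<lambda>x. 1) \<in> ?V" by (intro poly exp_poly_const)
  have ind: "(\<lambda>x. complex_of_real (indicator E x)) \<in> ?V" if E: "E \<in> sets M" for E
  proof -
    have "E \<in> sigma_sets UNIV (range (\<lambda>a::real. {..a}))"
      using E by (simp add: borel_eq_atMost)
    then show ?thesis
    proof (rule sigma_sets_induct_disjoint[rotated 2])
      show "Int_stable (range (\<lambda>a::real. {..a}))"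
        by (auto simp: Int_stable_def)
      show "range (\<lambda>a::real. {..a}) \<subseteq> Pow UNIV" by simp
      show "(\<lambda>x. complex_of_real (indicator X x)) \<in> ?V" if "X \<in> range (\<lambda>a::real. {..a})" for X
        using that atMost by auto
      show "(\<lambda>x. complex_of_real (indicator {} x)) \<in> ?V" by (simp add: span_closure_L2_zero)
      show "(\<lambda>x. complex_of_real (indicator (UNIV - X) x)) \<in> ?V"
        if "(\<lambda>x. complex_of_real (indicator X x)) \<in> ?V" for X
      proof -
        have "(\<lambda>x. complex_of_real (indicator (UNIV - X) x)) =
            (\<lambda>x. 1 + (- 1) * complex_of_real (indicator X x))"
          by (auto simp: indicator_def)
        then show ?thesis using span_closure_L2_add[OF \<phi> one span_closure_L2_scale[OF that, of "- 1"]] by simp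
      qed
      fix X :: "nat \<Rightarrow> real set" assume X: "disjoint_family X" "\<And>i. (\<lambda>x. complex_of_real (indicator (X i) x)) \<in> ?V"
      show "(\<lambda>x. complex_of_real (indicator (\<Union>i. X i) x)) \<in> ?V"
      proof (rule span_closure_L2_dominated[OF \<phi>])
        show "(\<lambda>x. \<Sum>i<n. complex_of_real (indicator (X i) x)) \<in> ?V" for n
          by (intro span_closure_L2_sum \<phi> X)
        have part: "(\<Sum>i<n. complex_of_real (indicator (X i) x)) = complex_of_real (indicator (\<Union>i<n. X i) x)" for n x
        proof -
          have "indicator (\<Union>i\<in>{..<n}. X i) x = (\<Sum>i<n. indicator (X i) x :: real)"
            using X(1) by (intro indicator_UN_disjoint) (auto simp: disjoint_family_on_def)
          then show ?thesis by simp
        qed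
        show "(\<lambda>n. \<Sum>i<n. complex_of_real (indicator (X i) x)) \<longlonglongrightarrow> complex_of_real (indicator (\<Union>i. X i) x)" for x
          unfolding part by (intro tendsto_of_real LIMSEQ_indicator_UN)
        show "norm (\<Sum>i<n. complex_of_real (indicator (X i) x)) \<le> 1" for n x
          unfolding part by (simp add: indicator_def)
      qed auto
    qed
  qed
  have simple: "s \<in> ?V" if s: "simple_function M s" for s
  proof -
    have fin: "finite (range s)" using s by (simp add: simple_function_def)
    have "s = (\<lambda>x. \<Sum>y\<in>range s. y * complex_of_real (indicator (s -` {y}) x))"
    proof
      fix x
      have "(\<Sum>y\<in>range s. y * complex_of_real (indicator (s -` {y}) x)) = (\<Sum>y\<in>range s. if s x = y then y else 0)"
        by (intro sum.cong) (auto simp: indicator_def)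
      also have "\<dots> = s x" using fin by (simp add: sum.delta)
      finally show "s x = (\<Sum>y\<in>range s. y * complex_of_real (indicator (s -` {y}) x))" by simp
    qed
    moreover have "s -` {y} \<in> sets M" for y
      using simple_functionD(2)[OF s, of "{y}"] by simp
    then have "(\<lambda>x. \<Sum>y\<in>range s. y * complex_of_real (indicator (s -` {y}) x)) \<in> ?V"
      by (intro span_closure_L2_sum \<phi> span_closure_L2_scale ind)
    ultimately show ?thesis by simp
  qed
  have fm: "f \<in> borel_measurable M" "integrable M (\<lambda>x. (norm (f x))\<^sup>2)"
    using f by (auto simp: square_integrable_def)
  obtain s where s: "\<And>i. simple_function M (s i)" "\<And>x. (\<lambda>i. s i x) \<longlonglongrightarrow> f x"
    "\<And>i x. dist (s i x) 0 \<le> 2 * dist (f x) 0"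
    using borel_measurable_implies_sequence_metric[OF fm(1), of 0] by auto
  show ?thesis
  proof (rule span_closure_L2_dominated[OF \<phi> simple[OF s(1)] s(2)])
    show "norm (s n x) \<le> 2 * norm (f x)" for n x using s(3)[of n x] by simp
    show "(\<lambda>x. 2 * norm (f x)) \<in> borel_measurable M" using fm(1) by simp
    show "integrable M (\<lambda>x. (2 * norm (f x))\<^sup>2)" using fm(2) by (simp add: power_mult_distrib)
  qed
qed

section \<open>The spectrum of the invariant measure\<close>

text \<open>One half of the duality: a digit set \<open>A\<close> with a dual set \<open>L\<close>. The complementary tile is only
felt through the absence of zeros of the transform in \<open>(-1,1)\<close>, and through \<open>R - 1 \<notin> L\<close>, which keeps
the points \<open>\<gamma> / R ^ n\<close> away from \<open>1\<close>.\<close>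

locale hadamard_ifs =
  fixes R :: nat and A L :: "nat set" and \<mu> :: "real measure"
  assumes R: "2 \<le> R"
    and finite_A: "finite A" and A_nonempty: "A \<noteq> {}"
    and L_subset: "L \<subseteq> {0..<R}" and zero_L: "0 \<in> L" and last_L: "R - 1 \<notin> L"
    and hadamard: "hadamard_nat R A L"
    and invariant: "is_invariant_measure R (real ` A) \<mu>"
    and support: "AE x in \<mu>. x \<in> {0..1}"
    and nonzero: "\<And>t. \<bar>t\<bar> < 1 \<Longrightarrow> fourier \<mu> t \<noteq> 0"
begin

sublocale real_distribution \<mu>
  using invariant by (rule is_invariant_measure_real_distribution)

abbreviation m :: "real \<Rightarrow> complex" where "m \<equiv> mask (real ` A)"

abbreviation D :: "nat \<Rightarrow> nat set" where "D \<equiv> digit_trunc R L"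

lemma finite_D: "finite (D n)"
  using digit_trunc_subset[OF L_subset] by (rule finite_subset) simp

lemma card_A_pos: "0 < card A"
  using finite_A A_nonempty by (simp add: card_gt_0_iff)

lemma refinement: "fourier \<mu> t = m (t / real R) * fourier \<mu> (t / real R)"
  by (rule fourier_invariant[OF _ _ invariant]) (use finite_A A_nonempty in auto)

lemma mask_periodic: "k \<in> \<int> \<Longrightarrow> m (t + k) = m t"
proof -
  assume k: "k \<in> \<int>"
  have "uexp (real a * (t + k)) = uexp (real a * t)" for a
  proof -
    have "uexp (real a * k) = 1" using k by (simp add: uexp_eq_1_iff)
    then show ?thesis by (simp add: distrib_left uexp_add)
  qed
  then show ?thesis by (simp add: mask_image)
qed

lemma mask_orthogonal:
  assumes "l \<in> L" "l' \<in> L" "l \<noteq> l'"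
  shows "m ((real l - real l') / real R) = 0"
proof -
  have "(\<Sum>a\<in>A. uexp (real a * ((real l - real l') / real R))) = (\<Sum>a\<in>A. uexp ((real l - real l') * real a / real R))"
    by (simp add: mult.commute)
  also have "\<dots> = 0" using hadamard assms by (simp add: hadamard_nat_def)
  finally show ?thesis by (simp add: mask_image)
qed

text \<open>The values of the mask at \<open>(t - l) / R\<close> are the coefficients of a unit vector in the orthonormal
basis given by the columns of the Hadamard matrix.\<close>

lemma mask_parseval: "(\<Sum>l\<in>L. (norm (m ((t - real l) / real R)))\<^sup>2) = 1"
proof -
  define N where "N = card A"
  have N: "0 < N" "card L = N" using hadamard card_A_pos by (simp_all add: N_def hadamard_nat_def)
  have inner: "(\<Sum>l\<in>L. uexp ((real a' - real a) * real l / real R)) = (if a = a' then of_nat N else 0)"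
    if "a \<in> A" "a' \<in> A" for a a'
    using that hadamard N by (auto simp: hadamard_nat_def)
  have "complex_of_real ((norm (m s))\<^sup>2) = (\<Sum>a\<in>A. \<Sum>a'\<in>A. uexp ((real a - real a') * s)) / (of_nat N)\<^sup>2" for s
    unfolding complex_norm_square mask_image
    by (simp add: sum_product cnj_uexp power2_eq_square N_def left_diff_distrib uexp_diff flip: cnj_uexp)
  then have "complex_of_real (\<Sum>l\<in>L. (norm (m ((t - real l) / real R)))\<^sup>2) =
      (\<Sum>l\<in>L. (\<Sum>a\<in>A. \<Sum>a'\<in>A. uexp ((real a - real a') * ((t - real l) / real R))) / (of_nat N)\<^sup>2)"
    by simp
  also have "\<dots> = (\<Sum>l\<in>L. \<Sum>a\<in>A. \<Sum>a'\<in>A. uexp ((real a - real a') * ((t - real l) / real R))) / (of_nat N)\<^sup>2"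
    by (simp add: sum_divide_distrib)
  also have "(\<Sum>l\<in>L. \<Sum>a\<in>A. \<Sum>a'\<in>A. uexp ((real a - real a') * ((t - real l) / real R))) =
      (\<Sum>a\<in>A. \<Sum>a'\<in>A. \<Sum>l\<in>L. uexp ((real a - real a') * ((t - real l) / real R)))"
    by (subst sum.swap) (simp add: sum.swap[where A = L])
  also have "\<dots> = (\<Sum>a\<in>A. \<Sum>a'\<in>A. uexp ((real a - real a') * t / real R) *
        (\<Sum>l\<in>L. uexp ((real a' - real a) * real l / real R)))"
  proof -
    have "uexp ((real a - real a') * ((t - real l) / real R)) =
      uexp ((real a - real a') * t / real R) * uexp ((real a' - real a) * real l / real R)" for a a' l
      unfolding uexp_add[symmetric]
      by (rule arg_cong[where f = uexp]) (simp add: algebra_simps diff_divide_distrib add_divide_distrib)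
    then show ?thesis by (simp add: sum_distrib_left)
  qed
  also have "\<dots> = (\<Sum>a\<in>A. \<Sum>a'\<in>A. if a = a' then of_nat N else 0)"
    by (intro sum.cong refl) (auto simp: inner)
  also have "\<dots> = (of_nat N)\<^sup>2"
    using finite_A by (simp add: power2_eq_square N_def)
  finally have "complex_of_real (\<Sum>l\<in>L. (norm (m ((t - real l) / real R)))\<^sup>2) = complex_of_real 1"
    using N by simp
  then show ?thesis by (simp only: of_real_eq_iff)
qed

text \<open>The squared modulus of the first \<open>n\<close> factors of the infinite product for the transform.\<close>

definition mask_prod :: "nat \<Rightarrow> real \<Rightarrow> real" where
  "mask_prod n t = (\<Prod>k<n. (norm (m (t / real R ^ Suc k)))\<^sup>2)"

lemma mask_prod_nonneg: "0 \<le> mask_prod n t"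
  by (simp add: mask_prod_def prod_nonneg)

lemma mask_prod_Suc: "mask_prod (Suc n) t = (norm (m (t / real R)))\<^sup>2 * mask_prod n (t / real R)"
  unfolding mask_prod_def by (subst prod.lessThan_Suc_shift) simp

text \<open>Split off the lowest digit of \<open>\<gamma>\<close>: by periodicity of the mask the first factor depends on that
digit only, the other factors form the sum for \<open>n - 1\<close> digits, and \<open>mask_parseval\<close> sums up the
first factors.\<close>

lemma sum_mask_prod: "(\<Sum>\<gamma>\<in>D n. mask_prod n (t - real \<gamma>)) = 1"
proof (induction n arbitrary: t)
  case 0
  show ?case by (simp add: mask_prod_def)
next
  case (Suc n)
  have R0: "real R \<noteq> 0" using R by simp
  have step: "mask_prod (Suc n) (t - real (l + R * g)) =
      (norm (m ((t - real l) / real R)))\<^sup>2 * mask_prod n ((t - real l) / real R - real g)" for l g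
  proof -
    have s: "(t - real (l + R * g)) / real R = (t - real l) / real R - real g"
      using R0 by (simp add: field_simps)
    have "- real g \<in> \<int>" by simp
    from mask_periodic[OF this, of "(t - real l) / real R"] show ?thesis
      unfolding mask_prod_Suc s by simp
  qed
  have "(\<Sum>\<gamma>\<in>D (Suc n). mask_prod (Suc n) (t - real \<gamma>)) =
      (\<Sum>l\<in>L. (norm (m ((t - real l) / real R)))\<^sup>2 * (\<Sum>g\<in>D n. mask_prod n ((t - real l) / real R - real g)))"
    unfolding digit_trunc.simps sum_digit_comb[OF L_subset] step by (simp add: sum_distrib_left)
  also have "\<dots> = 1" by (simp add: Suc.IH mask_parseval)
  finally show ?case .
qed

lemma norm_fourier_eq_mask_prod:
  "(norm (fourier \<mu> t))\<^sup>2 = mask_prod n t * (norm (fourier \<mu> (t / real R ^ n)))\<^sup>2"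
proof (induction n arbitrary: t)
  case 0
  show ?case by (simp add: mask_prod_def)
next
  case (Suc n)
  have "(norm (fourier \<mu> t))\<^sup>2 = (norm (m (t / real R)))\<^sup>2 * (norm (fourier \<mu> (t / real R)))\<^sup>2"
    by (subst refinement) (simp only: norm_mult power_mult_distrib)
  also have "\<dots> = (norm (m (t / real R)))\<^sup>2 *
      (mask_prod n (t / real R) * (norm (fourier \<mu> (t / real R / real R ^ n)))\<^sup>2)"
    by (simp only: Suc[of "t / real R"])
  also have "\<dots> = mask_prod (Suc n) t * (norm (fourier \<mu> (t / real R ^ Suc n)))\<^sup>2"
    by (simp add: mask_prod_Suc)
  finally show ?case .
qed

lemma norm_fourier_le_mask_prod: "(norm (fourier \<mu> t))\<^sup>2 \<le> mask_prod n t"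
proof -
  have "(norm (fourier \<mu> (t / real R ^ n)))\<^sup>2 \<le> 1"
    using norm_fourier_le_1[OF real_distribution_axioms] by (simp add: abs_square_le_1)
  then have "mask_prod n t * (norm (fourier \<mu> (t / real R ^ n)))\<^sup>2 \<le> mask_prod n t * 1"
    by (intro mult_left_mono mask_prod_nonneg)
  then show ?thesis by (simp flip: norm_fourier_eq_mask_prod)
qed

lemma mask_prod_tendsto: "(\<lambda>n. mask_prod n t) \<longlonglongrightarrow> (norm (fourier \<mu> t))\<^sup>2"
proof -
  have "(\<lambda>n. fourier \<mu> (t / real R ^ n)) \<longlonglongrightarrow> fourier \<mu> 0"
    by (intro isCont_tendsto_compose[OF isCont_fourier[OF real_distribution_axioms]] tendsto_divide_power_0 R)
  then have lim: "(\<lambda>n. (norm (fourier \<mu> (t / real R ^ n)))\<^sup>2) \<longlonglongrightarrow> 1"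
    using fourier_0[OF real_distribution_axioms] by (auto intro!: tendsto_eq_intros)
  have "(\<lambda>n. (norm (fourier \<mu> t))\<^sup>2 / (norm (fourier \<mu> (t / real R ^ n)))\<^sup>2) \<longlonglongrightarrow> (norm (fourier \<mu> t))\<^sup>2 / 1"
    by (intro tendsto_divide lim tendsto_const) simp
  moreover have "\<forall>\<^sub>F n in sequentially.
      (norm (fourier \<mu> t))\<^sup>2 / (norm (fourier \<mu> (t / real R ^ n)))\<^sup>2 = mask_prod n t"
    using tendsto_imp_eventually_ne[OF lim zero_neq_one[symmetric]]
  proof eventually_elim
    case (elim n)
    then show ?case using norm_fourier_eq_mask_prod[of t n] by simp
  qed
  ultimately show ?thesis by (simp add: tendsto_cong)
qed

text \<open>The largest digit is at most \<open>R - 2\<close>, so \<open>\<gamma>\<close> is at most the expansion with all digits equal to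
\<open>R - 2\<close>.\<close>

lemma D_bound: "\<gamma> \<in> D n \<Longrightarrow> real \<gamma> * (real R - 1) \<le> (real R - 2) * (real R ^ n - 1)"
proof (induction n arbitrary: \<gamma>)
  case (Suc n)
  then obtain l g where lg: "l \<in> L" "g \<in> D n" "\<gamma> = l + R * g" by (auto simp: digit_comb_def)
  have "l < R" "l \<noteq> R - 1" using lg L_subset last_L by auto
  then have "real l \<le> real R - 2" by linarith
  then have "real l * (real R - 1) \<le> (real R - 2) * (real R - 1)" using R by (intro mult_right_mono) auto
  moreover have "real R * (real g * (real R - 1)) \<le> real R * ((real R - 2) * (real R ^ n - 1))"
    by (intro mult_left_mono Suc.IH lg) simp
  ultimately show ?case by (simp add: lg algebra_simps)
qed simp

text \<open>By \<open>D_bound\<close> the points \<open>\<gamma> / R ^ n\<close> lie in \<open>[0,r]\<close> with \<open>r = (R - 2) / (R - 1) < 1\<close>, and \<open>t / R ^ n\<close>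
tends to \<open>0\<close>; so the points in question end up in a compact subset of \<open>(-1,1)\<close>, where the
transform is continuous and has no zero.\<close>

lemma D_tail_bound:
  obtains c where "0 < c"
    "\<forall>\<^sub>F n in sequentially. \<forall>\<gamma>\<in>D n. c \<le> (norm (fourier \<mu> ((t - real \<gamma>) / real R ^ n)))\<^sup>2"
proof -
  define r where "r = (real R - 2) / (real R - 1)"
  define \<rho> where "\<rho> = (1 + r) / 2"
  have r: "0 \<le> r" "r < 1" using R by (auto simp: r_def field_simps)
  then have \<rho>: "r < \<rho>" "\<rho> < 1" by (auto simp: \<rho>_def)
  have "continuous_on {-\<rho>..\<rho>} (\<lambda>s. (norm (fourier \<mu> s))\<^sup>2)"
    by (intro continuous_intros continuous_at_imp_continuous_on ballI isCont_fourier real_distribution_axioms)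
  then obtain s0 where s0: "s0 \<in> {-\<rho>..\<rho>}"
    "\<And>s. s \<in> {-\<rho>..\<rho>} \<Longrightarrow> (norm (fourier \<mu> s0))\<^sup>2 \<le> (norm (fourier \<mu> s))\<^sup>2"
    using continuous_attains_inf[of "{-\<rho>..\<rho>}" "\<lambda>s. (norm (fourier \<mu> s))\<^sup>2"] r \<rho> by auto
  show thesis
  proof (rule that)
    have "\<bar>s0\<bar> < 1" using s0(1) \<rho> by auto
    then show "0 < (norm (fourier \<mu> s0))\<^sup>2" using nonzero[of s0] by simp
    have "(\<lambda>n. \<bar>t / real R ^ n\<bar>) \<longlonglongrightarrow> \<bar>0\<bar>" by (intro tendsto_rabs tendsto_divide_power_0 R)
    then have "\<forall>\<^sub>F n in sequentially. \<bar>t / real R ^ n\<bar> < \<rho> - r" using \<rho> by (intro order_tendstoD) auto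
    then show "\<forall>\<^sub>F n in sequentially. \<forall>\<gamma>\<in>D n. (norm (fourier \<mu> s0))\<^sup>2 \<le> (norm (fourier \<mu> ((t - real \<gamma>) / real R ^ n)))\<^sup>2"
    proof (rule eventually_mono, intro ballI s0(2))
      fix n \<gamma> assume t: "\<bar>t / real R ^ n\<bar> < \<rho> - r" and \<gamma>: "\<gamma> \<in> D n"
      have pos: "0 < real R ^ n" using R by simp
      have "real \<gamma> * (real R - 1) \<le> (real R - 2) * (real R ^ n - 1)" by (rule D_bound[OF \<gamma>])
      also have "\<dots> \<le> (real R - 2) * real R ^ n" using R by (intro mult_left_mono) auto
      finally have "real \<gamma> \<le> r * real R ^ n" using R by (simp add: r_def field_simps)
      then have "real \<gamma> / real R ^ n \<le> r" using pos by (simp add: divide_le_eq)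
      moreover have "0 \<le> real \<gamma> / real R ^ n" by simp
      ultimately show "(t - real \<gamma>) / real R ^ n \<in> {-\<rho>..\<rho>}"
        using t \<rho> unfolding diff_divide_distrib atLeastAtMost_iff by linarith
    qed
  qed
qed

text \<open>For a fixed set of \<open>\<gamma>\<close> the partial products converge to the squared transform, so it suffices that
the remaining \<open>\<gamma>\<close> contribute little to \<open>sum_mask_prod\<close>. By \<open>D_tail_bound\<close> their partial products
are at most \<open>1 / c\<close> times the squared transform, whose sum over all \<open>\<gamma>\<close> converges.\<close>

lemma fourier_parseval_approx:
  assumes \<epsilon>: "0 < \<epsilon>"
  shows "\<exists>N. 1 - \<epsilon> < (\<Sum>\<gamma>\<in>D N. (norm (fourier \<mu> (t - real \<gamma>)))\<^sup>2)"
proof -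
  define F where "F = (\<lambda>\<gamma>. (norm (fourier \<mu> (t - real \<gamma>)))\<^sup>2)"
  define s where "s = (\<lambda>n. \<Sum>\<gamma>\<in>D n. F \<gamma>)"
  have s_le: "s n \<le> 1" for n
  proof -
    have "s n \<le> (\<Sum>\<gamma>\<in>D n. mask_prod n (t - real \<gamma>))"
      unfolding s_def F_def by (intro sum_mono norm_fourier_le_mask_prod)
    then show ?thesis by (simp add: sum_mask_prod)
  qed
  have inc: "incseq s"
    unfolding incseq_def s_def F_def
    by (intro allI impI sum_mono2 finite_D digit_trunc_mono zero_L) auto
  obtain \<sigma> where \<sigma>: "s \<longlonglongrightarrow> \<sigma>" "\<And>n. s n \<le> \<sigma>"
    using incseq_convergent[OF inc] s_le by metis
  obtain c where c: "0 < c" "\<forall>\<^sub>F n in sequentially. \<forall>\<gamma>\<in>D n. c \<le> (norm (fourier \<mu> ((t - real \<gamma>) / real R ^ n)))\<^sup>2"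
    using D_tail_bound by blast
  have "\<forall>\<^sub>F N in sequentially. \<sigma> - c * (\<epsilon> / 2) < s N" using \<sigma>(1) c \<epsilon> by (intro order_tendstoD) auto
  then obtain N where N: "\<sigma> - c * (\<epsilon> / 2) < s N" by (auto simp: eventually_sequentially)
  have lim: "(\<lambda>n. \<Sum>\<gamma>\<in>D N. mask_prod n (t - real \<gamma>)) \<longlonglongrightarrow> s N"
    unfolding s_def F_def by (intro tendsto_sum mask_prod_tendsto)
  have "\<forall>\<^sub>F n in sequentially. 1 - \<epsilon> / 2 \<le> (\<Sum>\<gamma>\<in>D N. mask_prod n (t - real \<gamma>))"
    using c(2) eventually_ge_at_top[of N]
  proof eventually_elim
    case (elim n)
    have sub: "D N \<subseteq> D n" using elim(2) by (intro digit_trunc_mono zero_L)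
    have "mask_prod n (t - real \<gamma>) \<le> F \<gamma> / c" if "\<gamma> \<in> D n" for \<gamma>
    proof -
      have "mask_prod n (t - real \<gamma>) * c \<le> F \<gamma>"
        unfolding F_def by (subst norm_fourier_eq_mask_prod[of _ n])
          (intro mult_left_mono mask_prod_nonneg elim(1)[rule_format] that)
      then show ?thesis using c by (simp add: field_simps)
    qed
    then have "(\<Sum>\<gamma>\<in>D n - D N. mask_prod n (t - real \<gamma>)) \<le> (\<Sum>\<gamma>\<in>D n - D N. F \<gamma> / c)"
      by (intro sum_mono) auto
    also have "\<dots> = (s n - s N) / c"
      unfolding s_def using sum_diff[OF finite_D sub, of F] by (simp flip: sum_divide_distrib)
    also have "\<dots> \<le> \<epsilon> / 2" using N \<sigma>(2)[of n] c by (simp add: field_simps)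
    finally have "(\<Sum>\<gamma>\<in>D n - D N. mask_prod n (t - real \<gamma>)) \<le> \<epsilon> / 2" .
    moreover have "(\<Sum>\<gamma>\<in>D n - D N. mask_prod n (t - real \<gamma>)) + (\<Sum>\<gamma>\<in>D N. mask_prod n (t - real \<gamma>)) = 1"
      using sum.subset_diff[OF sub finite_D, of "\<lambda>\<gamma>. mask_prod n (t - real \<gamma>)"] sum_mask_prod by simp
    ultimately show ?case by simp
  qed
  from tendsto_lowerbound[OF lim this] have "1 - \<epsilon> / 2 \<le> s N" by simp
  then show ?thesis using \<epsilon> by (intro exI[of _ N]) (simp add: s_def F_def)
qed

text \<open>If the lowest digits differ, the first factor of the transform is \<open>0\<close> by \<open>mask_orthogonal\<close>. If they
agree, remove them; the transform is then a multiple of its value at the shorter difference.\<close>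

lemma fourier_orthogonal:
  assumes "\<gamma> \<in> D n" "\<gamma>' \<in> D n" "\<gamma> \<noteq> \<gamma>'"
  shows "fourier \<mu> (real \<gamma> - real \<gamma>') = 0"
  using assms
proof (induction n arbitrary: \<gamma> \<gamma>')
  case (Suc n)
  obtain l g where 1: "l \<in> L" "g \<in> D n" "\<gamma> = l + R * g" using Suc.prems(1) by (auto simp: digit_comb_def)
  obtain l' g' where 2: "l' \<in> L" "g' \<in> D n" "\<gamma>' = l' + R * g'" using Suc.prems(2) by (auto simp: digit_comb_def)
  have R0: "real R \<noteq> 0" using R by simp
  have s: "(real \<gamma> - real \<gamma>') / real R = (real l - real l') / real R + (real g - real g')"
    using R0 by (simp add: 1 2 field_simps)
  have "real g - real g' \<in> \<int>" by simp
  from mask_periodic[OF this, of "(real l - real l') / real R"]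
  have eq: "fourier \<mu> (real \<gamma> - real \<gamma>') =
      m ((real l - real l') / real R) * fourier \<mu> ((real l - real l') / real R + (real g - real g'))"
    by (subst refinement) (simp add: s)
  show ?case
  proof (cases "l = l'")
    case True
    then have "g \<noteq> g'" using 1 2 Suc.prems by auto
    then show ?thesis using eq True Suc.IH[OF 1(2) 2(2)] by simp
  next
    case False
    then show ?thesis using eq mask_orthogonal[OF 1(1) 2(1)] by simp
  qed
qed simp

lemma integrable_uexp [simp]: "integrable \<mu> (\<lambda>x. uexp (t * x))"
  by (rule integrable_const_bound[of _ 1]) auto

lemma inner_uexp: "(LINT x|\<mu>. uexp (s * x) * cnj (uexp (t * x))) = fourier \<mu> (s - t)"
  by (simp add: fourier_def left_diff_distrib uexp_diff)

lemma square_integrable_uexp: "square_integrable \<mu> (\<lambda>x. uexp (t * x))"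
  by (simp add: square_integrable_def)

lemma fourier_uminus: "fourier \<mu> (- t) = cnj (fourier \<mu> t)"
proof -
  have "cnj (fourier \<mu> t) = (LINT x|\<mu>. cnj (uexp (t * x)))" unfolding fourier_def by simp
  then show ?thesis by (simp add: fourier_def cnj_uexp)
qed

text \<open>The Pythagorean identity for the orthogonal projection of an exponential, with the Fourier
coefficients \<open>fourier \<mu> (t - \<gamma>)\<close>.\<close>

lemma integral_residual:
  "(LINT x|\<mu>. (norm (uexp (t * x) - (\<Sum>\<gamma>\<in>D n. fourier \<mu> (t - real \<gamma>) * uexp (real \<gamma> * x))))\<^sup>2) =
     1 - (\<Sum>\<gamma>\<in>D n. (norm (fourier \<mu> (t - real \<gamma>)))\<^sup>2)"
proof -
  define c where "c = (\<lambda>\<gamma>. fourier \<mu> (t - real \<gamma>))"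
  define p where "p = (\<lambda>x. \<Sum>\<gamma>\<in>D n. c \<gamma> * uexp (real \<gamma> * x))"
  have int: "integrable \<mu> (\<lambda>x. uexp (s * x) * cnj (uexp (r * x)))" for s r
    by (simp flip: uexp_diff left_diff_distrib)
  have c0: "cnj (c \<gamma>) = fourier \<mu> (real \<gamma> - t)" for \<gamma>
    using fourier_uminus[of "t - real \<gamma>"] by (simp add: c_def)
  have inner_p: "(LINT x|\<mu>. p x * cnj (uexp (s * x))) = (\<Sum>\<gamma>\<in>D n. c \<gamma> * fourier \<mu> (real \<gamma> - s))"
    "integrable \<mu> (\<lambda>x. p x * cnj (uexp (s * x)))" for s
    unfolding p_def sum_distrib_right mult.assoc
    by (auto simp: int inner_uexp)
  have proj: "(LINT x|\<mu>. p x * cnj (uexp (real \<gamma> * x))) = c \<gamma>" if "\<gamma> \<in> D n" for \<gamma>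
  proof -
    have "(\<Sum>\<gamma>'\<in>D n. c \<gamma>' * fourier \<mu> (real \<gamma>' - real \<gamma>)) = (\<Sum>\<gamma>'\<in>D n. if \<gamma>' = \<gamma> then c \<gamma>' else 0)"
      using that fourier_orthogonal fourier_0[OF real_distribution_axioms] by (intro sum.cong) auto
    then show ?thesis using that finite_D by (simp add: inner_p)
  qed
  have pp: "(LINT x|\<mu>. p x * cnj (p x)) = (\<Sum>\<gamma>\<in>D n. cnj (c \<gamma>) * c \<gamma>)" "integrable \<mu> (\<lambda>x. p x * cnj (p x))"
  proof -
    have e: "p x * cnj (p x) = (\<Sum>\<gamma>\<in>D n. cnj (c \<gamma>) * (p x * cnj (uexp (real \<gamma> * x))))" for x
      by (subst (2) p_def) (simp add: sum_distrib_left mult_ac)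
    show "integrable \<mu> (\<lambda>x. p x * cnj (p x))" unfolding e by (intro Bochner_Integration.integrable_sum Bochner_Integration.integrable_mult_right inner_p(2))
    show "(LINT x|\<mu>. p x * cnj (p x)) = (\<Sum>\<gamma>\<in>D n. cnj (c \<gamma>) * c \<gamma>)"
      unfolding e by (subst Bochner_Integration.integral_sum) (auto simp: inner_p(2) proj)
  qed
  have ep: "(LINT x|\<mu>. uexp (t * x) * cnj (p x)) = (\<Sum>\<gamma>\<in>D n. cnj (c \<gamma>) * c \<gamma>)"
    "integrable \<mu> (\<lambda>x. uexp (t * x) * cnj (p x))"
  proof -
    have e: "uexp (t * x) * cnj (p x) = (\<Sum>\<gamma>\<in>D n. cnj (c \<gamma>) * (uexp (t * x) * cnj (uexp (real \<gamma> * x))))" for x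
      by (simp add: p_def sum_distrib_left mult_ac)
    show "integrable \<mu> (\<lambda>x. uexp (t * x) * cnj (p x))" unfolding e by (intro Bochner_Integration.integrable_sum Bochner_Integration.integrable_mult_right int)
    show "(LINT x|\<mu>. uexp (t * x) * cnj (p x)) = (\<Sum>\<gamma>\<in>D n. cnj (c \<gamma>) * c \<gamma>)"
      unfolding e by (subst Bochner_Integration.integral_sum) (auto simp: int inner_uexp c_def)
  qed
  have pe: "(LINT x|\<mu>. p x * cnj (uexp (t * x))) = (\<Sum>\<gamma>\<in>D n. cnj (c \<gamma>) * c \<gamma>)"
    unfolding inner_p(1) c0 by (simp only: mult.commute)
  have "complex_of_real (LINT x|\<mu>. (norm (uexp (t * x) - p x))\<^sup>2) = (LINT x|\<mu>. complex_of_real ((norm (uexp (t * x) - p x))\<^sup>2))"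
    by (rule integral_complex_of_real[symmetric])
  also have "\<dots> = (LINT x|\<mu>. (uexp (t * x) * cnj (uexp (t * x)) - uexp (t * x) * cnj (p x)) -
      (p x * cnj (uexp (t * x)) - p x * cnj (p x)))"
    unfolding complex_norm_square by (simp add: algebra_simps)
  also have "\<dots> = (1 - (\<Sum>\<gamma>\<in>D n. cnj (c \<gamma>) * c \<gamma>)) - ((\<Sum>\<gamma>\<in>D n. cnj (c \<gamma>) * c \<gamma>) - (\<Sum>\<gamma>\<in>D n. cnj (c \<gamma>) * c \<gamma>))"
    by (simp only: Bochner_Integration.integral_diff Bochner_Integration.integrable_diff int ep pe pp inner_p(2)
        inner_uexp diff_self fourier_0[OF real_distribution_axioms])
  also have "\<dots> = complex_of_real (1 - (\<Sum>\<gamma>\<in>D n. (norm (c \<gamma>))\<^sup>2))"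
    by (simp add: complex_norm_square mult.commute flip: of_real_power)
  finally show ?thesis unfolding of_real_eq_iff p_def c_def .
qed

theorem spectral: "spectral_with_spectrum \<mu> (real ` digit_sums R L)"
proof -
  let ?I = "real ` digit_sums R L"
  have I: "digit_sums R L = (\<Union>n. D n)" by (rule digit_sums_eq_Union[OF zero_L])
  have e: "e = (\<lambda>t x. uexp (t * x))" by (intro ext) (rule e_eq_uexp)
  have sq: "square_integrable \<mu> (e t)" for t unfolding e by (rule square_integrable_uexp)
  have orth: "(LINT x|\<mu>. e i x * cnj (e j x)) = (if i = j then 1 else 0)" if ij: "i \<in> ?I" "j \<in> ?I" for i j
  proof -
    obtain \<gamma> k \<gamma>' l where g: "i = real \<gamma>" "\<gamma> \<in> D k" "j = real \<gamma>'" "\<gamma>' \<in> D l" using ij unfolding I by blast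
    have "\<gamma> \<in> D (k + l)" "\<gamma>' \<in> D (k + l)"
      using g digit_trunc_mono[OF zero_L, of k "k + l" R] digit_trunc_mono[OF zero_L, of l "k + l" R] by auto
    then show ?thesis
      unfolding e inner_uexp using g fourier_orthogonal fourier_0[OF real_distribution_axioms] by auto
  qed
  have exp: "(\<lambda>x. uexp (t * x)) \<in> span_closure_L2 \<mu> ?I e" for t
    unfolding span_closure_L2_def
  proof (intro CollectI conjI allI impI square_integrable_uexp)
    fix \<epsilon> :: real assume "0 < \<epsilon>"
    then obtain N where N: "1 - \<epsilon> < (\<Sum>\<gamma>\<in>D N. (norm (fourier \<mu> (t - real \<gamma>)))\<^sup>2)"
      using fourier_parseval_approx by blast
    have "(\<Sum>i\<in>real ` D N. fourier \<mu> (t - i) * e i x) = (\<Sum>\<gamma>\<in>D N. fourier \<mu> (t - real \<gamma>) * uexp (real \<gamma> * x))" for x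
      by (simp add: sum.reindex inj_on_of_nat e)
    then have "(LINT x|\<mu>. (norm (uexp (t * x) - (\<Sum>i\<in>real ` D N. fourier \<mu> (t - i) * e i x)))\<^sup>2) < \<epsilon>"
      using N by (simp add: integral_residual)
    moreover have "finite (real ` D N)" "real ` D N \<subseteq> ?I" using finite_D unfolding I by auto
    ultimately show "\<exists>F c. finite F \<and> F \<subseteq> ?I \<and> (LINT x|\<mu>. (norm (uexp (t * x) - (\<Sum>i\<in>F. c i * e i x)))\<^sup>2) < \<epsilon>"
      by (intro exI[of _ "real ` D N"] exI[of _ "\<lambda>i. fourier \<mu> (t - i)"]) simp
  qed
  have dense: "\<exists>F c. finite F \<and> F \<subseteq> ?I \<and> sqrt (LINT x|\<mu>. (norm (f x - (\<Sum>i\<in>F. c i * e i x)))\<^sup>2) < \<epsilon>"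
    if f: "square_integrable \<mu> f" and \<epsilon>: "0 < \<epsilon>" for f \<epsilon>
  proof -
    have "f \<in> span_closure_L2 \<mu> ?I e"
      by (rule span_closure_L2_total[OF real_distribution_axioms support sq exp f])
    moreover have "0 < \<epsilon>\<^sup>2" using \<epsilon> by simp
    ultimately obtain F c where F: "finite F" "F \<subseteq> ?I" "(LINT x|\<mu>. (norm (f x - (\<Sum>i\<in>F. c i * e i x)))\<^sup>2) < \<epsilon>\<^sup>2"
      unfolding span_closure_L2_def by blast
    have "sqrt (LINT x|\<mu>. (norm (f x - (\<Sum>i\<in>F. c i * e i x)))\<^sup>2) < \<epsilon>"
      using real_sqrt_less_mono[OF F(3)] \<epsilon> by simp
    with F show ?thesis by blast
  qed
  show ?thesis
    unfolding spectral_with_spectrum_def orthonormal_basis_L2_def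
    using prob_space_axioms sq orth dense by auto
qed

end

text \<open>If \<open>R - 1\<close> were in \<open>L\<close>, then \<open>L'\<close> would have to be \<open>{0}\<close>, and \<open>A'\<close>, which has the same number of
elements and contains \<open>0\<close>, would be \<open>{0}\<close> too.\<close>

lemma picked_pair_spectral:
  assumes R: "2 \<le> R" and d: "direct_sum A A' {0..<R}" and ne: "A' \<noteq> {0}"
    and p: "picked_pair R A A' L L'"
  shows "spectral_with_spectrum (invariant_measure R (real ` A)) (real ` digit_sums R L)"
proof -
  have z: "0 \<in> {0..<R}" using R by simp
  have A: "A \<subseteq> {0..<R}" "A' \<subseteq> {0..<R}" using direct_sum_subset[OF d z] .
  have zA: "0 \<in> A" "0 \<in> A'" using direct_sum_zero_mem[OF d z] .
  have fin: "finite A" "finite A'" using A by (auto intro: finite_subset)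
  have pp: "finite L" "finite L'" "L \<subseteq> {0..<R}" "L' \<subseteq> {0..<R}" "direct_sum L L' {0..<R}"
    "hadamard_nat R A L" "hadamard_nat R A' L'"
    using p fin zA hadamard_system_iff_nat[of A L R] hadamard_system_iff_nat[of A' L' R]
    by (auto simp: picked_pair_def)
  have zL: "0 \<in> L" "0 \<in> L'" using direct_sum_zero_mem[OF pp(5) z] .
  note inv = invariant_measure_tile[OF R]
  have last: "R - 1 \<notin> L"
  proof
    assume "R - 1 \<in> L"
    have "l' = 0" if "l' \<in> L'" for l'
      using direct_sum_memD[OF pp(5) \<open>R - 1 \<in> L\<close> that] R by simp
    then have "L' = {0}" using zL by auto
    then have "card A' = 1" using pp(7) by (simp add: hadamard_nat_def)
    then show False using zA ne by (auto simp: card_1_singleton_iff)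
  qed
  interpret hadamard_ifs R A L "invariant_measure R (real ` A)"
  proof
    show "fourier (invariant_measure R (real ` A)) t \<noteq> 0" if "\<bar>t\<bar> < 1" for t
      using fourier_invariant_nonzero[OF R d inv(1)[OF A(1) zA(1)] inv(1)[OF A(2) zA(2)] that] .
  qed (use R fin zA pp zL last inv A in auto)
  show ?thesis by (rule spectral)
qed

section \<open>The product of the kernels\<close>

text \<open>Both kernels are power series in \<open>w = cnj z * e 1 x\<close>, and the exponents \<open>\<gamma> + \<gamma>'\<close> run through all
natural numbers exactly once.\<close>

lemma G_kernel_mult:
  assumes L: "direct_sum \<Gamma> \<Gamma>' UNIV" and z: "norm z < 1"
  shows "G_kernel \<Gamma> z x * G_kernel \<Gamma>' z x = szego_kernel z (e 1 x)"
proof -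
  define w where "w = cnj z * uexp x"
  have w: "norm w < 1" using z by (simp add: w_def norm_mult)
  have G: "G_kernel G z x = (\<Sum>\<^sub>\<infinity>\<gamma>\<in>G. w ^ \<gamma>)" for G
    unfolding G_kernel_def e_eq_uexp uexp_power w_def power_mult_distrib ..
  have geo: "((\<lambda>n. w ^ n) has_sum (1 / (1 - w))) UNIV"
    using norm_summable_imp_has_sum[of "\<lambda>n. w ^ n"] geometric_sums[OF w] w by (simp add: norm_power)
  from geo have all: "(\<Sum>\<^sub>\<infinity>n. w ^ n) = 1 / (1 - w)" by (rule infsumI)
  have bij: "bij_betw (\<lambda>(a, a'). a + a') (\<Gamma> \<times> \<Gamma>') UNIV" using L by (simp add: direct_sum_iff_bij_betw)
  have "(\<lambda>p. w ^ (case p of (a, a') \<Rightarrow> a + a')) summable_on \<Gamma> \<times> \<Gamma>'"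
    using summable_on_reindex_bij_betw[OF bij, of "\<lambda>n. w ^ n"] has_sum_imp_summable[OF geo] by blast
  then have sm: "(\<lambda>(a, a'). w ^ a * w ^ a') summable_on \<Gamma> \<times> \<Gamma>'"
    by (simp add: case_prod_beta' power_add)
  have "(\<Sum>\<^sub>\<infinity>n. w ^ n) = (\<Sum>\<^sub>\<infinity>p\<in>\<Gamma> \<times> \<Gamma>'. w ^ (case p of (a, a') \<Rightarrow> a + a'))"
    by (rule infsum_reindex_bij_betw[OF bij, symmetric])
  also have "\<dots> = (\<Sum>\<^sub>\<infinity>(a, a')\<in>\<Gamma> \<times> \<Gamma>'. w ^ a * w ^ a')"
    by (simp add: case_prod_beta' power_add)
  also have "\<dots> = (\<Sum>\<^sub>\<infinity>a\<in>\<Gamma>. \<Sum>\<^sub>\<infinity>a'\<in>\<Gamma>'. w ^ a * w ^ a')"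
    using infsum_Sigma'_banach[OF sm] by simp
  also have "\<dots> = (\<Sum>\<^sub>\<infinity>a\<in>\<Gamma>. w ^ a) * (\<Sum>\<^sub>\<infinity>a'\<in>\<Gamma>'. w ^ a')"
    by (simp add: infsum_cmult_right' infsum_cmult_left')
  finally show ?thesis
    using all by (simp add: G szego_kernel_def e_eq_uexp w_def)
qed

section \<open>The four statements for a tiling\<close>

theorem theorem2p11:
  fixes A A' :: "nat set" and R :: nat
  assumes "R \<ge> 2"
    and "direct_sum A A' {0..<R}"
    and "A \<noteq> {0}" and "A' \<noteq> {0}"
  shows
    "(Gcd A dvd R \<and> Gcd A' dvd R \<and> (\<exists>L L'. picked_pair R A A' L L')) \<and>
     convolution (invariant_measure R (real ` A)) (invariant_measure R (real ` A'))
       = density lborel (indicator {0..1}) \<and>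
     (\<forall>L L'. picked_pair R A A' L L' \<longrightarrow>
        spectral_with_spectrum (invariant_measure R (real ` A)) (real ` digit_sums R L) \<and>
        spectral_with_spectrum (invariant_measure R (real ` A')) (real ` digit_sums R L')) \<and>
     (\<forall>L L'. picked_pair R A A' L L' \<longrightarrow>
        (\<forall>z x. norm z < 1 \<longrightarrow>
           G_kernel (digit_sums R L) z x * G_kernel (digit_sums R L') z x
             = szego_kernel z (e 1 x)))"
proof (intro conjI)
  have z: "0 \<in> {0..<R}" using assms(1) by simp
  note d = assms(2) and d' = direct_sum_commute[OF assms(2)]
  note pairs = tiling_picked_pair[OF _ d]
  show "Gcd A dvd R" "Gcd A' dvd R" "\<exists>L L'. picked_pair R A A' L L'"
    using pairs assms by auto
  have inv: "is_invariant_measure R (real ` B) (invariant_measure R (real ` B))"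
    if "B \<subseteq> {0..<R}" "0 \<in> B" for B
    using invariant_measure_tile[OF assms(1) that] by blast
  show "convolution (invariant_measure R (real ` A)) (invariant_measure R (real ` A')) =
      density lborel (indicator {0..1})"
    using convolution_invariant_measures[OF assms(1) d] inv direct_sum_subset[OF d z] direct_sum_zero_mem[OF d z]
    by blast
  show "\<forall>L L'. picked_pair R A A' L L' \<longrightarrow>
      spectral_with_spectrum (invariant_measure R (real ` A)) (real ` digit_sums R L) \<and>
      spectral_with_spectrum (invariant_measure R (real ` A')) (real ` digit_sums R L')"
    using picked_pair_spectral[OF assms(1) d assms(4)] picked_pair_spectral[OF assms(1) d' assms(3)]
      picked_pair_commute by blast
  show "\<forall>L L'. picked_pair R A A' L L' \<longrightarrow>
      (\<forall>z x. norm z < 1 \<longrightarrow>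
         G_kernel (digit_sums R L) z x * G_kernel (digit_sums R L') z x = szego_kernel z (e 1 x))"
  proof (intro allI impI)
    fix L L' z x assume p: "picked_pair R A A' L L'" and z: "norm (z :: complex) < 1"
    then have "direct_sum L L' {0..<R}" by (simp add: picked_pair_def)
    from G_kernel_mult[OF direct_sum_digit_sums[OF this assms(1)] z]
    show "G_kernel (digit_sums R L) z x * G_kernel (digit_sums R L') z x = szego_kernel z (e 1 x)" .
  qed
qed

end
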